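(* Let $F$ be a field, let $R$ be a noncommutative simple $F$-algebra, and let $p\in F[x]$ be a nonconstant polynomial. Then $p[R,R]^+=[R,R]$ and $\overline{p[R,R]}=R$, except when $|R|<\infty$ (that is, both equalities hold whenever $R$ is infinite).
   Context: Algebras are associative, not necessarily unital. $R$ is simple if $R^2\ne0$ and its only two-sided ideals are $0$ and $R$. For $a,b\in R$, $[a,b]=ab-ba$, and $[R,R]$ is the additive subgroup of $R$ generated by all $[a,b]$ with $a,b\in R$. $p[R,R]=\{p(ab)-p(ba)\mid a,b\in R\}$ (when $R$ is non-unital, $p$ is implicitly assumed to have no constant term). For a subset $X\subseteq R$, $X^+$ (respectively $\overline X$) denotes the additive subgroup (respectively subring) of $R$ generated by $X$. *)

theory Defs
  imports
    "HOL-Computational_Algebra.Polynomial"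
    "HOL-Computational_Algebra.Group_Closure"
begin

text \<open>
  The class \<open>ring\<close> is the class of associative rings without a unit requirement.
\<close>

locale assoc_algebra = vector_space scale
  for scale :: "'f::field \<Rightarrow> 'a::ring \<Rightarrow> 'a" (infixr \<open>*s\<close> 75) +
  assumes scale_mult_left: "(c *s x) * y = c *s (x * y)"
    and scale_mult_right: "x * (c *s y) = c *s (x * y)"
begin

definition two_sided_ideal :: "'a set \<Rightarrow> bool"
  where "two_sided_ideal I \<longleftrightarrow>
    subspace I \<and> (\<forall>r. \<forall>x\<in>I. r * x \<in> I \<and> x * r \<in> I)"

end

locale simple_algebra = assoc_algebra scale
  for scale :: "'f::field \<Rightarrow> 'a::ring \<Rightarrow> 'a" (infixr \<open>*s\<close> 75) +
  assumes square_nonzero: "\<exists>x y :: 'a. x * y \<noteq> 0"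
    and trivial_ideals: "two_sided_ideal I \<Longrightarrow> I = {0} \<or> I = UNIV"

definition identity_element :: "'a::ring \<Rightarrow> bool"
  where "identity_element e \<longleftrightarrow> (\<forall>x. e * x = x \<and> x * e = x)"

definition unital :: "'a::ring itself \<Rightarrow> bool"
  where "unital _ \<longleftrightarrow> (\<exists>e :: 'a. identity_element e)"

text \<open>
  \<open>ring_power x n\<close> is the power of \<open>x\<close> with exponent \<open>n + 1\<close>; the operation \<open>^\<close>
  needs a unit in the type class.
\<close>

primrec ring_power :: "'a::ring \<Rightarrow> nat \<Rightarrow> 'a"
  where
    "ring_power x 0 = x"
  | "ring_power x (Suc n) = x * ring_power x n"

text \<open>
  The constant term contributes a multiple of the identity element if there is one. If there is
  none, the value is meaningful only for polynomials with zero constant term.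
\<close>

definition eval_poly :: "('f::field \<Rightarrow> 'a::ring \<Rightarrow> 'a) \<Rightarrow> 'f poly \<Rightarrow> 'a \<Rightarrow> 'a"
  where "eval_poly scale p x =
    (if unital TYPE('a) then scale (coeff p 0) (THE e. identity_element e) else 0)
    + (\<Sum>i<degree p. scale (coeff p (Suc i)) (ring_power x i))"

definition poly_commutators :: "('f::field \<Rightarrow> 'a::ring \<Rightarrow> 'a) \<Rightarrow> 'f poly \<Rightarrow> 'a set"
  where "poly_commutators scale p =
    {eval_poly scale p (a * b) - eval_poly scale p (b * a) | a b. True}"

definition commutator_group :: "'a::ring set"
  where "commutator_group = group_closure {a * b - b * a | a b. True}"

definition is_subring :: "'a::ring set \<Rightarrow> bool"
  where "is_subring S \<longleftrightarrow>
    0 \<in> S \<and> (\<forall>x\<in>S. \<forall>y\<in>S. x - y \<in> S \<and> x * y \<in> S)"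

definition subring_closure :: "'a::ring set \<Rightarrow> 'a set"
  where "subring_closure X = is_subring hull X"

end

(*
  Write n = deg p, p = sum c_k x^k, and let A be the additive group generated by all p(ab) - p(ba).
  For an additive group P the set T(P) = {x. [x, R] <= P} is a subring, and if P is a Lie ideal then
  T(P) is a Lie ideal containing P.  A noncommutative subring of R that is a Lie ideal is all of R.
  So a Lie ideal P with noncommutative T(P) contains [R, R], and it suffices to find such a P close
  to A.  Let C be the centroid of R, a field.

  C infinite: let P be the C-span of all (ab)^n - (ba)^n.  Scaling a and b and extracting one
  coefficient of a polynomial map from C gives [P, R] <= A and shows that P is a Lie ideal.  If T(P)
  were commutative, it would be central unless char R = 2, where it would contain x with [x, u] = 1
  for some unit u, and x + 1/u as a conjugate of x.  If it were central, then a^(2n) would be central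
  for all a, which forces R to be commutative.

  C finite: let P be spanned by the values of the full polarization of c_n ((ab)^n - (ba)^n), a
  multilinear polynomial with values in A.  P does not commute as soon as R contains 4n elements
  whose product is not in the group generated by the products in other orders.  If some nonzero
  aRb is finite, R has infinitely many orthogonal idempotents e_i, and elements of e_i R e_(i+1)
  work.  Otherwise no nonzero map x |-> sum a_i x b_i has finite image, and since C is finite one can
  choose the elements one after the other with all words in them independent over C.
*)
theory Submission
  imports Defs "HOL-Library.FuncSet"
begin

text \<open>A priori \<open>A\<close> is stable neither under F nor under C, so the homogeneous
  parts of p cannot be separated by inverting a Vandermonde matrix, which would multiply elements of
  \<open>A\<close> by scalars. For infinite C the substitute is the vanishing of iterated
  differences (\<open>poly_map\<close>), which needs only addition. It puts only the brackets [P, R]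
  into \<open>A\<close>; the gap is closed by [R, R] = [[R, R], R]. For finite C there are too few
  scalars for any such extraction; there inclusion-exclusion over 2n pairs of arguments kills all
  words shorter than 2n, hence all lower powers. A product of two polarizations has 4n factors,
  whence the 4n elements. Scalars are taken from C because C may be infinite when F is finite, and
  because a r b = b r a for all r, with a nonzero, forces b to be in C a
  (\<open>martindale\<close>). Exponents are shifted: \<open>ring_power x k\<close> has exponent k +
  1, so m = n - 1, and 4n elements have last index 4m + 3.\<close>

definition add_subgroup :: "'a::ab_group_add set \<Rightarrow> bool"
  where "add_subgroup S \<longleftrightarrow> 0 \<in> S \<and> (\<forall>x\<in>S. \<forall>y\<in>S. x - y \<in> S)"

lemma add_subgroupD:
  assumes "add_subgroup S"
  shows "0 \<in> S" "\<And>x y. x \<in> S \<Longrightarrow> y \<in> S \<Longrightarrow> x - y \<in> S"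
    "\<And>x. x \<in> S \<Longrightarrow> - x \<in> S" "\<And>x y. x \<in> S \<Longrightarrow> y \<in> S \<Longrightarrow> x + y \<in> S"
proof -
  show 0: "0 \<in> S" and d: "\<And>x y. x \<in> S \<Longrightarrow> y \<in> S \<Longrightarrow> x - y \<in> S"
    using assms by (auto simp: add_subgroup_def)
  show n: "- x \<in> S" if "x \<in> S" for x
    using d[OF 0 that] by simp
  show "x + y \<in> S" if "x \<in> S" "y \<in> S" for x y
    using d[OF that(1) n[OF that(2)]] by simp
qed

lemma add_subgroup_sum:
  assumes "add_subgroup S" "\<And>i. i \<in> I \<Longrightarrow> f i \<in> S"
  shows "sum f I \<in> S"
  using assms(2) by (induction I rule: infinite_finite_induct) (auto intro: add_subgroupD[OF assms(1)])

lemma add_subgroup_group_closure [simp]: "add_subgroup (group_closure X)"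
  unfolding add_subgroup_def by (auto intro: group_closure.intros)

lemma group_closure_least:
  assumes "add_subgroup S" "X \<subseteq> S"
  shows "group_closure X \<subseteq> S"
proof
  fix x assume "x \<in> group_closure X"
  then show "x \<in> S"
    by induction (use assms in \<open>auto simp: add_subgroup_def\<close>)
qed

lemma group_closure_induct_subset:
  assumes "x \<in> group_closure X" "add_subgroup S" "X \<subseteq> S"
  shows "x \<in> S"
  using group_closure_least assms by blast

lemma is_subring_add_subgroup: "is_subring S \<Longrightarrow> add_subgroup S"
  by (auto simp: is_subring_def add_subgroup_def)

lemma additive_minus_zero:
  fixes f :: "'a::ab_group_add \<Rightarrow> 'b::ab_group_add"
  assumes "\<And>x y. f (x + y) = f x + f y"
  shows "f 0 = 0" "f (- x) = - f x" "f (x - y) = f x - f y" "f (sum g I) = (\<Sum>i\<in>I. f (g i))"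
proof -
  show z: "f 0 = 0"
    using assms[of 0 0] by simp
  show m: "f (- x) = - f x" for x
    using assms[of x "- x"] z by (simp add: eq_neg_iff_add_eq_0 add.commute)
  show "f (x - y) = f x - f y"
    using assms[of x "- y"] m by simp
  show "f (sum g I) = (\<Sum>i\<in>I. f (g i))"
    by (induction I rule: infinite_finite_induct) (auto simp: z assms)
qed

definition lie :: "'a::ring \<Rightarrow> 'a \<Rightarrow> 'a"
  where "lie x y = x * y - y * x"

lemma lie_simps:
  "lie (x + y) z = lie x z + lie y z" "lie x (y + z) = lie x y + lie x z"
  "lie (x - y) z = lie x z - lie y z" "lie x (y - z) = lie x y - lie x z"
  "lie (- x) z = - lie x z" "lie x (- z) = - lie x z"
  "lie 0 x = 0" "lie x 0 = 0" "lie x x = 0"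
  by (simp_all add: lie_def algebra_simps)

lemma lie_mult_right: "lie x (y * z) = lie x y * z + y * lie x z"
  by (simp add: lie_def algebra_simps)

lemma lie_mult_left: "lie (x * y) z = x * lie y z + lie x z * y"
  by (simp add: lie_def algebra_simps)

lemma lie_skew: "lie x y = - lie y x"
  by (simp add: lie_def)

lemma lie_eq_0_iff: "lie x y = 0 \<longleftrightarrow> x * y = y * x"
  by (simp add: lie_def)

lemma lie_sum_left: "lie (sum f I) y = (\<Sum>i\<in>I. lie (f i) y)"
  by (rule additive_minus_zero(4)) (simp add: lie_simps)

lemma commutator_group_eq: "commutator_group = group_closure {lie a b | a b. True}"
  by (simp add: commutator_group_def lie_def)

definition central :: "'a::ring \<Rightarrow> bool"
  where "central x \<longleftrightarrow> (\<forall>r. lie x r = 0)"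

lemma centralD: "central x \<Longrightarrow> x * r = r * x"
  by (simp add: central_def lie_eq_0_iff)

lemma add_subgroup_central: "add_subgroup {x. central x}"
  by (auto simp: add_subgroup_def central_def lie_simps)

section \<open>The centroid\<close>

text \<open>These maps commute with all left and right multiplications. Over a simple ring they form
  a field (\<open>centroid_inverse\<close>), in which the coefficients of \<open>p\<close>
  act.\<close>

typedef (overloaded) ('a::ring) centroid =
  "{f :: 'a \<Rightarrow> 'a. (\<forall>x y. f (x + y) = f x + f y) \<and>
    (\<forall>x y. f (x * y) = f x * y) \<and> (\<forall>x y. f (x * y) = x * f y)}"
  morphisms app_centroid Centroid
  by (rule exI[of _ "\<lambda>x. x"]) simp

setup_lifting type_definition_centroid

notation app_centroid (infixr \<open>\<bullet>\<close> 75)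

lemma centroid_add_right: "c \<bullet> (x + y) = c \<bullet> x + c \<bullet> y"
  using app_centroid[of c] by simp

lemma centroid_mult_left: "(c \<bullet> x) * y = c \<bullet> (x * y)"
  using app_centroid[of c] by simp

lemma centroid_mult_right: "x * (c \<bullet> y) = c \<bullet> (x * y)"
  using app_centroid[of c] by auto

lemmas centroid_zero_right [simp] = additive_minus_zero(1)[of "app_centroid c" for c, OF centroid_add_right]
lemmas centroid_minus_right = additive_minus_zero(2)[of "app_centroid c" for c, OF centroid_add_right]
lemmas centroid_diff_right = additive_minus_zero(3)[of "app_centroid c" for c, OF centroid_add_right]
lemmas centroid_sum_right = additive_minus_zero(4)[of "app_centroid c" for c, OF centroid_add_right]

lemma centroid_eqI: "(\<And>x. c \<bullet> x = d \<bullet> x) \<Longrightarrow> c = d"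
  by transfer auto

lemma centroid_lie: "lie (c \<bullet> x) y = c \<bullet> lie x y" "lie x (c \<bullet> y) = c \<bullet> lie x y"
  by (simp_all add: lie_def centroid_mult_left centroid_mult_right centroid_diff_right)

text \<open>Commutativity and inverses depend on simplicity, a locale assumption, and 0 = 1 over the
  trivial ring; so the classes stop short of \<open>ring_1\<close> and fields.\<close>

instantiation centroid :: (ring) "{ring, monoid_mult}"
begin

lift_definition zero_centroid :: "'a centroid" is "\<lambda>x. 0" by simp
lift_definition one_centroid :: "'a centroid" is "\<lambda>x. x" by simp
lift_definition plus_centroid :: "'a centroid \<Rightarrow> 'a centroid \<Rightarrow> 'a centroid"
  is "\<lambda>f g x. f x + g x" by (auto simp: algebra_simps)
lift_definition minus_centroid :: "'a centroid \<Rightarrow> 'a centroid \<Rightarrow> 'a centroid"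
  is "\<lambda>f g x. f x - g x" by (auto simp: algebra_simps)
lift_definition uminus_centroid :: "'a centroid \<Rightarrow> 'a centroid"
  is "\<lambda>f x. - f x" by (auto simp: algebra_simps)
lift_definition times_centroid :: "'a centroid \<Rightarrow> 'a centroid \<Rightarrow> 'a centroid"
  is "\<lambda>f g x. f (g x)" by (elim CollectE conjE, intro CollectI conjI allI) metis+

instance
  by standard (transfer; auto simp: algebra_simps fun_eq_iff)+

end

lemma centroid_app_simps [simp]:
  "0 \<bullet> x = 0" "1 \<bullet> x = x" "(c * d) \<bullet> x = c \<bullet> d \<bullet> x"
  "(- c) \<bullet> x = - (c \<bullet> x)"
  by (transfer; simp)+

lemma centroid_add_left: "(c + d) \<bullet> x = c \<bullet> x + d \<bullet> x"
  by (transfer; simp)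

lemma centroid_diff_left: "(c - d) \<bullet> x = c \<bullet> x - d \<bullet> x"
  by (transfer; simp)

section \<open>Polynomial maps in the sense of Frechet\<close>

text \<open>Degree at most \<open>N\<close>: all (N+1)-fold differences vanish. Only addition is
  involved, so values can be compared modulo an additive group that no scalars preserve.\<close>

primrec poly_map :: "nat \<Rightarrow> ('s::ab_group_add \<Rightarrow> 'r::ab_group_add) \<Rightarrow> bool"
  where
    "poly_map 0 H \<longleftrightarrow> (\<forall>s t. H s = H t)"
  | "poly_map (Suc N) H \<longleftrightarrow> (\<forall>t. poly_map N (\<lambda>s. H (s + t) - H s))"

lemma poly_map_const: "poly_map N (\<lambda>s. c)"
  by (induction N arbitrary: c) auto

lemma poly_map_Suc: "poly_map N H \<Longrightarrow> poly_map (Suc N) H"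
proof (induction N arbitrary: H)
  case 0
  then show ?case by simp metis
next
  case (Suc N)
  have "poly_map (Suc N) (\<lambda>s. H (s + t) - H s)" for t
    by (rule Suc.IH) (use Suc.prems in simp)
  then show ?case unfolding poly_map.simps(2)[of "Suc N"] by blast
qed

lemma poly_map_mono: "poly_map N H \<Longrightarrow> N \<le> M \<Longrightarrow> poly_map M H"
  by (induction M) (auto simp: le_Suc_eq intro: poly_map_Suc simp del: poly_map.simps)

lemma poly_map_shift: "poly_map N H \<Longrightarrow> poly_map N (\<lambda>s. H (s + t))"
proof (induction N arbitrary: H)
  case 0
  then show ?case by simp
next
  case (Suc N)
  have "poly_map N (\<lambda>s. H (s + t + u) - H (s + t))" for u
    using Suc.IH[of "\<lambda>s. H (s + u) - H s"] Suc.prems by simp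
  then show ?case by (simp add: ac_simps)
qed

lemma poly_map_add: "poly_map N H \<Longrightarrow> poly_map N G \<Longrightarrow> poly_map N (\<lambda>s. H s + G s)"
proof (induction N arbitrary: H G)
  case 0
  then show ?case by simp metis
next
  case (Suc N)
  have "poly_map N (\<lambda>s. (H (s + t) - H s) + (G (s + t) - G s))" for t
    by (rule Suc.IH) (use Suc.prems in simp_all)
  then show ?case by (simp add: algebra_simps)
qed

lemma poly_map_additive:
  fixes f :: "'b::ab_group_add \<Rightarrow> 'c::ab_group_add"
  assumes f: "\<And>x y. f (x + y) = f x + f y"
  shows "poly_map N H \<Longrightarrow> poly_map N (\<lambda>s. f (H s))"
proof (induction N arbitrary: H)
  case 0
  then show ?case by simp metis
next
  case (Suc N)
  have "poly_map N (\<lambda>s. f (H (s + t) - H s))" for t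
    by (rule Suc.IH) (use Suc.prems in simp_all)
  then show ?case by (simp add: additive_minus_zero(3)[of f, OF f])
qed

text \<open>Leibniz rule: a difference of \<open>B (H s) (G s)\<close> splits into a difference in
  \<open>H\<close> and one in \<open>G\<close>, each of total degree one less. If one degree is 0,
  that factor is constant and \<open>B\<close> is additive in the other.\<close>

lemma poly_map_biadditive:
  fixes B :: "'b::ab_group_add \<Rightarrow> 'c::ab_group_add \<Rightarrow> 'd::ab_group_add"
  assumes l: "\<And>x y z. B (x + y) z = B x z + B y z" and r: "\<And>x y z. B x (y + z) = B x y + B x z"
  shows "poly_map N H \<Longrightarrow> poly_map M G \<Longrightarrow> poly_map (N + M) (\<lambda>s. B (H s) (G s))"
proof (induction "N + M" arbitrary: N M H G)
  case 0
  then show ?case by simp metis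
next
  case (Suc K)
  show ?case
  proof (cases "N = 0 \<or> M = 0")
    case True
    then show ?thesis
    proof
      assume "N = 0"
      then have "H s = H 0" for s using Suc.prems by simp
      then have "(\<lambda>s. B (H s) (G s)) = (\<lambda>s. B (H 0) (G s))" by metis
      then show ?thesis using poly_map_additive[of "B (H 0)", OF r] Suc.prems \<open>N = 0\<close> by simp
    next
      assume "M = 0"
      then have "G s = G 0" for s using Suc.prems by simp
      then have "(\<lambda>s. B (H s) (G s)) = (\<lambda>s. B (H s) (G 0))" by metis
      then show ?thesis using poly_map_additive[of "\<lambda>x. B x (G 0)", OF l] Suc.prems \<open>M = 0\<close> by simp
    qed
  next
    case False
    then obtain n m where nm: "N = Suc n" "M = Suc m" by (meson not0_implies_Suc)
    have K: "K = n + M" "K = N + m" using Suc.hyps nm by simp_all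
    have "poly_map K (\<lambda>s. B (H (s + t) - H s) (G (s + t)) + B (H s) (G (s + t) - G s))" for t
    proof (rule poly_map_add)
      show "poly_map K (\<lambda>s. B (H (s + t) - H s) (G (s + t)))"
        unfolding K(1) by (rule Suc.hyps(1)[OF K(1)]) (use Suc.prems nm poly_map_shift[of M G] in simp_all)
      show "poly_map K (\<lambda>s. B (H s) (G (s + t) - G s))"
        unfolding K(2) by (rule Suc.hyps(1)[OF K(2)]) (use Suc.prems nm in simp_all)
    qed
    moreover have "B (H (s + t) - H s) (G (s + t)) + B (H s) (G (s + t) - G s)
        = B (H (s + t)) (G (s + t)) - B (H s) (G s)" for s t
      using additive_minus_zero(3)[of "B (H s)", OF r] additive_minus_zero(3)[of "\<lambda>x. B x (G (s + t))", OF l]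
      by simp
    ultimately show ?thesis
      unfolding Suc.hyps(2)[symmetric] by simp
  qed
qed

text \<open>A substitute for Vandermonde arguments that works although \<open>A\<close> is only an additive group.\<close>

lemma poly_map_zero_mem:
  fixes H :: "'s::ab_group_add \<Rightarrow> 'r::ab_group_add"
  assumes "infinite (UNIV :: 's set)" "add_subgroup A"
  shows "poly_map N H \<Longrightarrow> finite X \<Longrightarrow> (\<And>s. s \<notin> X \<Longrightarrow> H s \<in> A) \<Longrightarrow> H 0 \<in> A"
proof (induction N arbitrary: H X)
  case 0
  then obtain s where "s \<notin> X" using assms(1) ex_new_if_finite by blast
  then show ?case using 0 by (metis poly_map.simps(1))
next
  case (Suc N)
  \<comment> \<open>\<open>H 0\<close> is \<open>H t\<close> minus the difference
    \<open>H t - H 0\<close>. The difference map has lower degree and lies in \<open>A\<close>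
    unless \<open>s\<close> or \<open>s + t\<close> is in \<open>X\<close>, again a finite set of
    exceptions.\<close>
  obtain t where t: "t \<notin> X" using assms(1) Suc.prems ex_new_if_finite by blast
  have "H (0 + t) - H 0 \<in> A"
  proof (rule Suc.IH)
    show "poly_map N (\<lambda>s. H (s + t) - H s)" using Suc.prems by simp
    show "finite (X \<union> (\<lambda>x. x - t) ` X)" using Suc.prems by simp
    show "H (s + t) - H s \<in> A" if "s \<notin> X \<union> (\<lambda>x. x - t) ` X" for s
    proof -
      have "s + t \<notin> X"
        using that by (metis UnI2 add_diff_cancel_right' imageI)
      then show ?thesis
        using that Suc.prems(3) add_subgroupD(2)[OF assms(2)] by blast
    qed
  qed
  with Suc.prems(3)[OF t] show ?case
    using add_subgroupD(2)[OF assms(2)] by fastforce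
qed

definition polynomial_map :: "('s::ab_group_add \<Rightarrow> 'r::ab_group_add) \<Rightarrow> bool"
  where "polynomial_map H \<longleftrightarrow> (\<exists>N. poly_map N H)"

lemma polynomial_map_const: "polynomial_map (\<lambda>s. c)"
  using poly_map_const by (auto simp: polynomial_map_def)

lemma polynomial_map_ident: "polynomial_map (\<lambda>s. s)"
  unfolding polynomial_map_def by (rule exI[of _ 1]) simp

lemma polynomial_map_add:
  assumes "polynomial_map H" "polynomial_map G"
  shows "polynomial_map (\<lambda>s. H s + G s)"
proof -
  obtain N M where "poly_map N H" "poly_map M G"
    using assms by (auto simp: polynomial_map_def)
  then have "poly_map (max N M) (\<lambda>s. H s + G s)"
    by (intro poly_map_add) (auto intro: poly_map_mono)
  then show ?thesis by (auto simp: polynomial_map_def)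
qed

lemma polynomial_map_sum:
  "(\<And>i. i \<in> I \<Longrightarrow> polynomial_map (H i)) \<Longrightarrow> polynomial_map (\<lambda>s. \<Sum>i\<in>I. H i s)"
  by (induction I rule: infinite_finite_induct) (auto intro: polynomial_map_const polynomial_map_add)

lemma polynomial_map_biadditive:
  assumes "\<And>x y z. B (x + y) z = B x z + B y z" "\<And>x y z. B x (y + z) = B x y + B x z"
    and "polynomial_map H" "polynomial_map G"
  shows "polynomial_map (\<lambda>s. B (H s) (G s))"
proof -
  obtain N M where "poly_map N H" "poly_map M G"
    using assms by (auto simp: polynomial_map_def)
  then have "poly_map (N + M) (\<lambda>s. B (H s) (G s))"
    by (rule poly_map_biadditive[of B, OF assms(1,2)])
  then show ?thesis by (auto simp: polynomial_map_def)
qed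

lemma polynomial_map_additive:
  assumes "\<And>x y. f (x + y) = f x + f y" and "polynomial_map H"
  shows "polynomial_map (\<lambda>s. f (H s))"
proof -
  obtain N where "poly_map N H"
    using assms by (auto simp: polynomial_map_def)
  then have "poly_map N (\<lambda>s. f (H s))"
    by (rule poly_map_additive[of f, OF assms(1)])
  then show ?thesis by (auto simp: polynomial_map_def)
qed

lemma polynomial_map_mult:
  fixes H G :: "'s::ab_group_add \<Rightarrow> 'r::ring"
  shows "polynomial_map H \<Longrightarrow> polynomial_map G \<Longrightarrow> polynomial_map (\<lambda>s. H s * G s)"
  by (rule polynomial_map_biadditive) (simp_all add: algebra_simps)

lemma polynomial_map_uminus: "polynomial_map H \<Longrightarrow> polynomial_map (\<lambda>s. - H s)"
  by (rule polynomial_map_additive) simp_all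

lemma polynomial_map_diff: "polynomial_map H \<Longrightarrow> polynomial_map G \<Longrightarrow> polynomial_map (\<lambda>s. H s - G s)"
  using polynomial_map_add[of H "\<lambda>s. - G s"] polynomial_map_uminus[of G] by simp

lemma polynomial_map_app:
  "polynomial_map H \<Longrightarrow> polynomial_map G \<Longrightarrow> polynomial_map (\<lambda>s. H s \<bullet> G s)"
  by (rule polynomial_map_biadditive) (simp_all add: centroid_add_left centroid_add_right)

lemma polynomial_map_power:
  fixes H :: "'s::ab_group_add \<Rightarrow> 'a::ring centroid"
  shows "polynomial_map H \<Longrightarrow> polynomial_map (\<lambda>s. H s ^ n)"
  by (induction n) (auto intro: polynomial_map_const polynomial_map_mult)

lemma polynomial_map_zero_mem:
  fixes H :: "'s::ab_group_add \<Rightarrow> 'r::ab_group_add"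
  assumes "infinite (UNIV :: 's set)" "add_subgroup A" "polynomial_map H"
    "\<And>s. s \<noteq> 0 \<Longrightarrow> H s \<in> A"
  shows "H 0 \<in> A"
  using poly_map_zero_mem[OF assms(1,2), of _ H "{0}"] assms(3,4) by (auto simp: polynomial_map_def)

section \<open>Simple rings\<close>

text \<open>Ideals are additive subgroups here and not subspaces, so that all scalars come from the
  centroid; \<open>simple_algebra.simple_rng\<close> gives the passage.\<close>

locale simple_rng =
  fixes ty :: "'a::ring itself"
  assumes square_nonzero: "\<exists>x y :: 'a. x * y \<noteq> 0"
    and trivial_ideals: "\<And>I :: 'a set. add_subgroup I \<Longrightarrow>
      (\<And>r x. x \<in> I \<Longrightarrow> r * x \<in> I \<and> x * r \<in> I) \<Longrightarrow> I = {0} \<or> I = UNIV"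
begin

lemma left_annihilator: "x = 0" if "\<And>r. r * x = 0" for x :: 'a
proof -
  let ?I = "{x :: 'a. \<forall>r. r * x = 0}"
  have "?I = {0} \<or> ?I = UNIV"
  proof (rule trivial_ideals)
    show "add_subgroup ?I" by (simp add: add_subgroup_def algebra_simps)
    show "r * x \<in> ?I \<and> x * r \<in> ?I" if "x \<in> ?I" for r x
      using that by (simp add: mult.assoc[symmetric])
  qed
  moreover have "?I \<noteq> UNIV" using square_nonzero by auto
  ultimately show ?thesis using that by blast
qed

lemma right_annihilator: "x = 0" if "\<And>r. x * r = 0" for x :: 'a
proof -
  let ?I = "{x :: 'a. \<forall>r. x * r = 0}"
  have "?I = {0} \<or> ?I = UNIV"
  proof (rule trivial_ideals)
    show "add_subgroup ?I" by (simp add: add_subgroup_def algebra_simps)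
    show "r * x \<in> ?I \<and> x * r \<in> ?I" if "x \<in> ?I" for r x
      using that by (simp add: mult.assoc)
  qed
  moreover have "?I \<noteq> UNIV" using square_nonzero by auto
  ultimately show ?thesis using that by blast
qed

lemma prime: "a = 0 \<or> b = 0" if "\<And>r. a * r * b = 0" for a b :: 'a
proof (rule disjCI)
  assume b: "b \<noteq> 0"
  let ?I = "{x :: 'a. \<forall>r. x * r * b = 0}"
  have "?I = {0} \<or> ?I = UNIV"
  proof (rule trivial_ideals)
    show "add_subgroup ?I" by (simp add: add_subgroup_def algebra_simps)
    show "r * x \<in> ?I \<and> x * r \<in> ?I" if "x \<in> ?I" for r x
      using that by (auto simp: mult.assoc) (metis mult.assoc)
  qed
  moreover have "?I \<noteq> UNIV"
  proof
    assume "?I = UNIV"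
    then have "x * (r * b) = 0" for x r by (auto simp: mult.assoc)
    then have "r * b = 0" for r using left_annihilator by blast
    then show False using b left_annihilator by blast
  qed
  ultimately show "a = 0" using that by blast
qed

text \<open>The additive span of R a R is a nonzero ideal, hence R. This serves as an induction
  principle: a property stable under differences need only be checked on
  \<open>u * a * v\<close>.\<close>

lemma generated: "x \<in> S" if "a \<noteq> 0" "add_subgroup S" "\<And>u v. u * a * v \<in> S" for a x :: 'a
proof -
  let ?I = "group_closure {u * a * v | u v. True}"
  have "?I = {0} \<or> ?I = UNIV"
  proof (rule trivial_ideals)
    show "add_subgroup ?I" by simp
    fix r x assume x: "x \<in> ?I"
    have "?I \<subseteq> {x. r * x \<in> ?I \<and> x * r \<in> ?I}"
    proof (rule group_closure_least)
      show "add_subgroup {x. r * x \<in> ?I \<and> x * r \<in> ?I}"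
        using add_subgroupD[OF add_subgroup_group_closure[of "{u * a * v | u v. True}"]]
        by (simp add: add_subgroup_def right_diff_distrib left_diff_distrib)
      have "r * (u * a * v) \<in> ?I \<and> u * a * v * r \<in> ?I" for u v
      proof
        have "r * (u * a * v) = (r * u) * a * v" "u * a * v * r = u * a * (v * r)"
          by (simp_all add: mult.assoc)
        then show "r * (u * a * v) \<in> ?I" "u * a * v * r \<in> ?I"
          using group_closure.base[of _ "{u * a * v | u v. True}"] by blast+
      qed
      then show "{u * a * v | u v. True} \<subseteq> {x. r * x \<in> ?I \<and> x * r \<in> ?I}" by blast
    qed
    then show "r * x \<in> ?I \<and> x * r \<in> ?I" using x by blast
  qed
  moreover have "?I \<noteq> {0}"
  proof
    assume "?I = {0}"
    moreover have "u * a * v \<in> ?I" for u v by (rule group_closure.base) auto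
    ultimately have "u * a * v = 0" for u v by (metis singletonD)
    then have "u * a = 0" for u using right_annihilator by blast
    then show False using that(1) left_annihilator by blast
  qed
  moreover have "?I \<subseteq> S" using that by (intro group_closure_least) auto
  ultimately show ?thesis by blast
qed

lemma centroid_commute: "c * d = d * c" for c d :: "'a centroid"
proof (rule centroid_eqI)
  obtain a b :: 'a where ab: "a * b \<noteq> 0" using square_nonzero by blast
  fix x :: 'a
  have "x \<in> {x. c \<bullet> d \<bullet> x = d \<bullet> c \<bullet> x}"
  proof (rule generated[OF ab])
    show "add_subgroup {x. c \<bullet> d \<bullet> x = d \<bullet> c \<bullet> x}"
      by (simp add: add_subgroup_def centroid_diff_right)
    show "u * (a * b) * v \<in> {x. c \<bullet> d \<bullet> x = d \<bullet> c \<bullet> x}" for u v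
      by (simp, metis centroid_mult_left centroid_mult_right)
  qed
  then show "(c * d) \<bullet> x = (d * c) \<bullet> x" by simp
qed

lemma centroid_app_eq_0: "c = 0 \<or> x = 0" if "c \<bullet> x = 0" for c :: "'a centroid"
proof -
  have "{x. c \<bullet> x = 0} = {0} \<or> {x. c \<bullet> x = 0} = UNIV"
  proof (rule trivial_ideals)
    show "add_subgroup {x. c \<bullet> x = 0}"
      by (simp add: add_subgroup_def centroid_diff_right)
    show "r * x \<in> {x. c \<bullet> x = 0} \<and> x * r \<in> {x. c \<bullet> x = 0}" if "x \<in> {x. c \<bullet> x = 0}" for r x
      using centroid_mult_left[of c x r] centroid_mult_right[of r c x] that by simp
  qed
  moreover have "c = 0" if "{x. c \<bullet> x = 0} = UNIV"
    by (rule centroid_eqI) (use that in auto)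
  ultimately show ?thesis using that by blast
qed

text \<open>Schur's lemma: kernel and range of \<open>c\<close> are ideals.\<close>

lemma centroid_inverse: "\<exists>d. c * d = 1 \<and> d * c = 1" if "c \<noteq> 0" for c :: "'a centroid"
proof -
  have inj: "x = y" if "c \<bullet> x = c \<bullet> y" for x y
    using centroid_app_eq_0[of c "x - y"] \<open>c \<noteq> 0\<close> that by (simp add: centroid_diff_right)
  have "range (app_centroid c) = {0} \<or> range (app_centroid c) = UNIV"
  proof (rule trivial_ideals)
    show "add_subgroup (range (app_centroid c))"
      unfolding add_subgroup_def by (auto simp flip: centroid_diff_right intro: rev_image_eqI[of 0])
    show "r * x \<in> range (app_centroid c) \<and> x * r \<in> range (app_centroid c)"
      if "x \<in> range (app_centroid c)" for r x
      using that by (auto simp: centroid_mult_left centroid_mult_right)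
  qed
  moreover have "range (app_centroid c) \<noteq> {0}"
    using that centroid_eqI[of c 0] by force
  ultimately have "\<forall>x. \<exists>y. c \<bullet> y = x" by (metis rangeE UNIV_I)
  then obtain f where f: "c \<bullet> f x = x" for x by metis
  have f': "f \<in> {f. (\<forall>x y. f (x + y) = f x + f y) \<and>
    (\<forall>x y. f (x * y) = f x * y) \<and> (\<forall>x y. f (x * y) = x * f y)}"
  proof (intro CollectI conjI allI)
    fix x y
    show "f (x + y) = f x + f y" by (rule inj) (simp add: f centroid_add_right)
    show "f (x * y) = f x * y" by (rule inj) (simp add: f centroid_mult_left[symmetric])
    show "f (x * y) = x * f y" by (rule inj) (simp add: f centroid_mult_right[symmetric])
  qed
  then have "c * Centroid f = 1"
    by (intro centroid_eqI) (simp only: centroid_app_simps Centroid_inverse[OF f'] f)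
  then show ?thesis using centroid_commute by metis
qed

text \<open>The sought map sends \<open>u * a * v\<close> to \<open>u * b * v\<close>. The relation
  \<open>?P x y\<close> describes its graph independently of representations, and is single-valued
  because R is prime.\<close>

lemma martindale: "\<exists>c :: 'a centroid. b = c \<bullet> a"
  if ab: "\<And>r. a * r * b = b * r * a" and a: "a \<noteq> 0" for a b :: 'a
proof -
  let ?P = "\<lambda>x y. \<forall>r. b * r * x = a * r * y"
  have ex: "x \<in> {x. \<exists>y. ?P x y}" for x
  proof (rule generated[OF a])
    show "add_subgroup {x. \<exists>y. ?P x y}"
    proof (unfold add_subgroup_def, safe)
      show "\<exists>y. ?P 0 y" by (rule exI[of _ 0]) simp
      fix x x' y y' assume "?P x y" "?P x' y'"
      then show "\<exists>y. ?P (x - x') y" by (intro exI[of _ "y - y'"]) (simp add: algebra_simps)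
    qed
    fix u v
    have "?P (u * a * v) (u * b * v)"
    proof
      fix r show "b * r * (u * a * v) = a * r * (u * b * v)"
        using arg_cong[OF ab[of "r * u"], of "\<lambda>z. z * v"] by (simp add: mult.assoc)
    qed
    then show "u * a * v \<in> {x. \<exists>y. ?P x y}" by blast
  qed
  have "\<forall>x. \<exists>y. ?P x y" using ex by simp
  from choice[OF this] obtain f where f: "b * r * x = a * r * f x" for x r by blast
  have uniq: "y = y'" if "?P x y" "?P x y'" for x y y'
  proof -
    have "a * r * (y - y') = 0" for r
      using that by (simp add: right_diff_distrib)
    then show ?thesis using prime[of a "y - y'"] a by simp
  qed
  have "f \<in> {f. (\<forall>x y. f (x + y) = f x + f y) \<and>
    (\<forall>x y. f (x * y) = f x * y) \<and> (\<forall>x y. f (x * y) = x * f y)}"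
  proof (intro CollectI conjI allI)
    fix x y
    show "f (x + y) = f x + f y"
      by (rule uniq[of "x + y"]) (simp_all add: f[symmetric] distrib_left)
    show "f (x * y) = f x * y"
      by (rule uniq[of "x * y"]) (simp_all add: f[symmetric] mult.assoc[symmetric])
    have "b * r * (x * y) = a * r * (x * f y)" for r
      using f[of "r * x" y] by (simp add: mult.assoc)
    then show "f (x * y) = x * f y"
      using uniq[of "x * y"] f[of _ "x * y"] by blast
  qed
  moreover have "f a = b" by (rule uniq[of a]) (simp_all add: f[symmetric] ab)
  ultimately show ?thesis by (intro exI[of _ "Centroid f"]) (simp only: Centroid_inverse)
qed

text \<open>Multiplication by \<open>z\<close> is a nonzero, hence invertible, centroid element. Its
  inverse \<open>d\<close> sends \<open>z\<close> to an identity and that identity to the inverse of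
  \<open>z\<close>.\<close>

lemma central_unit:
  fixes z :: 'a
  assumes "central z" "z \<noteq> 0"
  obtains e z' where "identity_element e" "central z'" "z' * z = e"
proof -
  let ?f = "\<lambda>x. z * x"
  have f: "?f \<in> {f. (\<forall>x y. f (x + y) = f x + f y) \<and>
    (\<forall>x y. f (x * y) = f x * y) \<and> (\<forall>x y. f (x * y) = x * f y)}"
  proof (intro CollectI conjI allI)
    fix x y
    show "z * (x * y) = x * (z * y)"
      by (metis centralD[OF assms(1)] mult.assoc)
  qed (simp_all add: distrib_left mult.assoc)
  define c where "c = Centroid ?f"
  have c: "c \<bullet> x = z * x" for x using f by (simp only: c_def Centroid_inverse[OF f])
  have "c \<noteq> 0"
  proof
    assume "c = 0"
    then have "z * x = 0" for x using c[of x] by simp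
    then show False using right_annihilator assms(2) by blast
  qed
  then obtain d where d: "c * d = 1" "d * c = 1" using centroid_inverse by blast
  have d': "c \<bullet> d \<bullet> x = x" "d \<bullet> c \<bullet> x = x" for x
    using arg_cong[OF d(1), of "\<lambda>c. c \<bullet> x"] arg_cong[OF d(2), of "\<lambda>c. c \<bullet> x"] by simp_all
  define e where "e = d \<bullet> z"
  have e: "e * x = x" for x
    unfolding e_def centroid_mult_left c[symmetric] by (rule d')
  have ce: "central e" unfolding central_def e_def centroid_lie
    using assms(1) by (simp add: central_def)
  have "identity_element e"
    unfolding identity_element_def using e centralD[OF ce] by metis
  moreover have "central (d \<bullet> e)"
    using ce by (simp add: central_def centroid_lie)
  moreover have "(d \<bullet> e) * z = e"
    by (simp add: centroid_mult_left e) (simp add: e_def)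
  ultimately show thesis using that by blast
qed

text \<open>Bracketing [x, xr] = x [x, r] with \<open>s\<close> gives [x, s][x, r] = 0, so the
  central element c = [x, r] satisfies c R c = 0.\<close>

lemma lie_all_central: "central x" if x: "\<And>r. central (lie x r)" for x :: 'a
proof -
  have "lie x r = 0" for r
  proof -
    have "lie (x * lie x r) s = 0" for s
      using x[of "x * r"] unfolding central_def by (simp add: lie_mult_right lie_simps)
    then have "lie x s * lie x r = 0" for s
      using x[of r] by (simp add: lie_mult_left central_def)
    then have "lie x r * s * lie x r = 0" for s
      using centralD[OF x[of r], of s] by (metis mult.assoc mult_zero_right)
    then show ?thesis using prime by blast
  qed
  then show ?thesis by (simp add: central_def)
qed

lemma central_mult_central: "central z \<Longrightarrow> central (z * x) \<Longrightarrow> z = 0 \<or> central x" for x z :: 'a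
proof (rule disjCI)
  assume z: "central z" "central (z * x)" "\<not> central x"
  then obtain r where r: "lie x r \<noteq> 0" by (auto simp: central_def)
  have "z * lie x s = 0" for s
    using z(1,2) by (simp add: central_def lie_mult_left)
  then have "z * s * lie x r = 0" for s
    by (metis centralD z(1) mult.assoc mult_zero_right)
  then show "z = 0" using prime r by blast
qed

section \<open>Lie ideals\<close>

definition lie_ideal :: "'a set \<Rightarrow> bool"
  where "lie_ideal P \<longleftrightarrow> add_subgroup P \<and> (\<forall>x\<in>P. \<forall>r. lie x r \<in> P)"

lemma lie_ideal_add_subgroup: "lie_ideal P \<Longrightarrow> add_subgroup P"
  by (simp add: lie_ideal_def)

lemma lie_idealD: "lie_ideal P \<Longrightarrow> x \<in> P \<Longrightarrow> lie x r \<in> P" "lie_ideal P \<Longrightarrow> x \<in> P \<Longrightarrow> lie r x \<in> P"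
  using lie_skew[of r x] add_subgroupD(3)[of P] by (auto simp: lie_ideal_def)

text \<open>Herstein's argument: [x, y] r = [x, y r] - y [x, r] lies in \<open>T\<close>, a bracket
  with \<open>s\<close> then puts s [x, y] r there, and these elements generate R.\<close>

lemma subring_lie_ideal_UNIV:
  assumes T: "is_subring T" "lie_ideal T" and xy: "x \<in> T" "y \<in> T" "lie x y \<noteq> 0"
  shows "T = UNIV"
proof -
  note d = add_subgroupD[OF lie_ideal_add_subgroup[OF T(2)]]
  have m: "u \<in> T \<Longrightarrow> v \<in> T \<Longrightarrow> u * v \<in> T" for u v
    using T(1) by (simp add: is_subring_def)
  have 1: "lie x y * r \<in> T" for r
    using d(2)[OF lie_idealD(1)[OF T(2) xy(1), of "y * r"] m[OF xy(2) lie_idealD(1)[OF T(2) xy(1), of r]]]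
    by (simp add: lie_mult_right)
  have "s * lie x y * r \<in> T" for r s
    using d(2)[OF 1[of "r * s"] lie_idealD(1)[OF T(2) 1[of r], of s]]
    by (simp add: lie_def mult.assoc)
  then show ?thesis
    using generated[OF xy(3) lie_ideal_add_subgroup[OF T(2)]] by blast
qed

text \<open>The set of all \<open>x\<close> with \<open>[x, R] \<subseteq> P\<close> is a subring because \<open>[xy, r] = [x, yr] + [y, rx]\<close>.\<close>

definition transporter :: "'a set \<Rightarrow> 'a set"
  where "transporter P = {x. \<forall>r. lie x r \<in> P}"

lemma transporter_subring: "is_subring (transporter P)" if P: "add_subgroup P"
proof -
  note d = add_subgroupD[OF P]
  have "lie (x * y) r \<in> P" if "x \<in> transporter P" "y \<in> transporter P" for x y r
  proof -
    have "lie (x * y) r = lie x (y * r) + lie y (r * x)"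
      by (simp add: lie_def algebra_simps)
    then show ?thesis using that d(4) by (simp add: transporter_def)
  qed
  then show ?thesis
    using d by (auto simp: is_subring_def transporter_def lie_simps)
qed

lemma subset_transporter: "lie_ideal P \<Longrightarrow> P \<subseteq> transporter P"
  by (auto simp: transporter_def lie_idealD)

lemma transporter_lie_ideal: "lie_ideal (transporter P)" if "lie_ideal P"
  using that subset_transporter[OF that]
    is_subring_add_subgroup[OF transporter_subring[OF lie_ideal_add_subgroup[OF that]]]
  by (auto simp: lie_ideal_def transporter_def)

lemma commutator_group_subset:
  assumes P: "lie_ideal P" and "x \<in> transporter P" "y \<in> transporter P" "lie x y \<noteq> 0"
  shows "commutator_group \<subseteq> P"
proof -
  have "transporter P = UNIV"
    using subring_lie_ideal_UNIV[OF transporter_subring transporter_lie_ideal] assms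
      lie_ideal_add_subgroup by blast
  then show ?thesis
    unfolding commutator_group_eq
    by (intro group_closure_least lie_ideal_add_subgroup[OF P]) (auto simp: transporter_def)
qed

text \<open>If commutators commuted, bracketing [x, rx] = [x, r] x with a commutator would give
  [x, r][x, [c, d]] = 0; inserting a factor and primeness make all commutators central, so R is
  commutative. This works in every characteristic.\<close>

lemma noncommuting_commutators:
  assumes "a * b \<noteq> b * (a :: 'a)"
  obtains p q r s :: 'a where "lie (lie p q) (lie r s) \<noteq> 0"
proof (rule ccontr)
  assume "\<not> thesis"
  then have 0: "lie (lie p q) (lie r s) = 0" for p q r s :: 'a using that by blast
  have 1: "lie x r * lie x (lie c d) = 0" for x r c d :: 'a
    using 0[of x "r * x" c d] 0[of x x c d] 0[of x r c d]
    by (simp add: lie_mult_right lie_mult_left lie_simps)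
  have 2: "lie x r * s * lie x (lie c d) = 0" for x r s c d :: 'a
    using 1[of x "r * s" c d] 1[of x s c d]
    by (simp add: lie_mult_right distrib_right mult.assoc)
  have 3: "lie x (lie c d) = 0" for x c d :: 'a
  proof (rule ccontr)
    assume x: "lie x (lie c d) \<noteq> 0"
    then have "lie x r = 0" for r using prime[OF 2, of x r c d] by blast
    then show False using x by blast
  qed
  have "central (lie x r)" for x r :: 'a
    using 3 lie_skew[of "lie x r"] by (simp add: central_def)
  then have "central a" by (rule lie_all_central)
  then show False using assms centralD by metis
qed

lemma commutator_group_lie_ideal: "lie_ideal commutator_group"
  unfolding lie_ideal_def commutator_group_eq by (auto intro: group_closure.base)

text \<open>This repairs the loss from \<open>P\<close> to [P, R]: the span of [[R, R], R] is a Lie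
  ideal whose transporter contains noncommuting commutators, hence it contains [R, R].\<close>

lemma commutator_subset_if_brackets:
  fixes P A :: "'a set"
  assumes nc: "a * b \<noteq> b * (a :: 'a)" and P: "commutator_group \<subseteq> P" "add_subgroup A"
    and PA: "\<And>x r. x \<in> P \<Longrightarrow> lie x r \<in> A"
  shows "commutator_group \<subseteq> A"
proof -
  let ?U = "group_closure {lie x r | (x :: 'a) r. x \<in> commutator_group}"
  have U: "lie_ideal ?U"
    unfolding lie_ideal_def
  proof (intro conjI ballI allI)
    fix x r assume "x \<in> ?U"
    moreover have "?U \<subseteq> commutator_group"
      by (rule group_closure_least) (use commutator_group_lie_ideal in \<open>auto simp: lie_ideal_def\<close>)
    ultimately show "lie x r \<in> ?U" by (auto intro: group_closure.base)
  qed simp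
  obtain p q r s :: 'a where pq: "lie (lie p q) (lie r s) \<noteq> 0"
    using noncommuting_commutators[OF nc] .
  have "lie p q \<in> transporter ?U" for p q
    by (auto simp: transporter_def commutator_group_eq intro!: group_closure.base)
  then have "commutator_group \<subseteq> ?U"
    using commutator_group_subset[OF U _ _ pq] by blast
  also have "\<dots> \<subseteq> A"
    by (rule group_closure_least[OF P(2)]) (use P(1) PA in auto)
  finally show ?thesis .
qed

text \<open>A subring that contains all commutators is a Lie ideal, and it is not
  commutative.\<close>

lemma subring_closure_commutators:
  fixes X :: "'a set"
  assumes nc: "a * b \<noteq> b * (a :: 'a)" and X: "commutator_group \<subseteq> group_closure X"
  shows "subring_closure X = UNIV"
proof -
  let ?S = "subring_closure X"
  have S: "is_subring ?S"
    unfolding subring_closure_def by (rule hull_in) (auto simp: is_subring_def)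
  have "X \<subseteq> ?S" unfolding subring_closure_def by (rule hull_subset)
  then have c: "commutator_group \<subseteq> ?S"
    using X group_closure_least[OF is_subring_add_subgroup[OF S]] by blast
  have l: "lie x y \<in> ?S" for x y
    using c by (auto simp: commutator_group_eq intro: group_closure.base)
  obtain p q r s :: 'a where "lie (lie p q) (lie r s) \<noteq> 0"
    using noncommuting_commutators[OF nc] .
  then show ?thesis
    using subring_lie_ideal_UNIV[OF S] l is_subring_add_subgroup[OF S]
    by (metis lie_ideal_def)
qed

end

section \<open>Power commutators and an infinite centroid\<close>

lemma ring_power_commute: "a * x = x * a \<Longrightarrow> a * ring_power x n = ring_power x n * a"
proof (induction n)
  case (Suc n)
  have "a * ring_power x (Suc n) = x * (a * ring_power x n)"
    using Suc.prems by (simp flip: mult.assoc)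
  then show ?case using Suc by (simp add: mult.assoc)
qed simp

lemma ring_power_mult: "ring_power x m * ring_power x n = ring_power x (Suc (m + n))"
  by (induction m) (simp_all add: mult.assoc)

lemma ring_power_double: "ring_power (a * a) m = ring_power a (2 * m + 1)"
  by (induction m) (simp_all add: mult.assoc)

lemma ring_power_scale: "ring_power (t \<bullet> x) k = t ^ Suc k \<bullet> ring_power x k"
proof (induction k)
  case (Suc k)
  have "t ^ Suc k \<bullet> t \<bullet> z = t \<bullet> t ^ Suc k \<bullet> z" for z
    by (metis power_commutes centroid_app_simps(3))
  then show ?case using Suc by (simp add: centroid_mult_left centroid_mult_right)
qed simp

lemma ring_power_eq_funpow:
  "ring_power x k * z = ((\<lambda>z. x * z) ^^ Suc k) z"
  by (induction k) (simp_all add: mult.assoc)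

text \<open>The coefficient of t in the power of x + t w with exponent n + 1.\<close>

primrec power_deriv :: "'a::ring \<Rightarrow> 'a \<Rightarrow> nat \<Rightarrow> 'a"
  where
    "power_deriv x w 0 = w"
  | "power_deriv x w (Suc n) = x * power_deriv x w n + w * ring_power x n"

text \<open>[_, r] is a derivation, so differentiating a power of \<open>y\<close> in the direction
  [y, r] brackets the power itself.\<close>

lemma power_deriv_lie: "power_deriv y (lie y r) n = lie (ring_power y n) r"
  by (induction n) (simp_all add: lie_mult_left)

lemma power_deriv_add: "power_deriv y (v + w) n = power_deriv y v n + power_deriv y w n"
  by (induction n) (simp_all add: algebra_simps)

lemma power_deriv_diff: "power_deriv y (v - w) n = power_deriv y v n - power_deriv y w n"
  by (induction n) (simp_all add: left_diff_distrib right_diff_distrib)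

lemma power_deriv_mult_right:
  assumes "a * y = y * a"
  shows "power_deriv y (w * a) n = power_deriv y w n * a"
  using ring_power_commute[OF assms] by (induction n) (simp_all add: algebra_simps)

lemma power_deriv_mult_left:
  assumes "a * y = y * a"
  shows "power_deriv y (a * w) n = a * power_deriv y w n"
proof (induction n)
  case (Suc n)
  have "y * (a * power_deriv y w n) = a * (y * power_deriv y w n)"
    by (metis assms mult.assoc)
  then show ?case using Suc by (simp add: distrib_left mult.assoc)
qed simp

definition power_commutator :: "nat \<Rightarrow> 'a::ring \<Rightarrow> 'a \<Rightarrow> 'a"
  where "power_commutator k a b = ring_power (a * b) k - ring_power (b * a) k"

lemma power_commutator_scale:
  "power_commutator k (t \<bullet> a) b = t ^ Suc k \<bullet> power_commutator k a b"
  by (simp add: power_commutator_def centroid_mult_left centroid_mult_right ring_power_scale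
      centroid_diff_right)

text \<open>Expansion modulo the square of \<tau>. The parameter is a function of \<open>s\<close>
  because it is sometimes \<open>s\<close> itself and, in \<open>bracket_leading_mem\<close>, a
  power of \<open>s\<close>.\<close>

definition jet :: "('a::ring centroid \<Rightarrow> 'a centroid) \<Rightarrow> ('a centroid \<Rightarrow> 'a) \<Rightarrow> 'a \<Rightarrow> 'a \<Rightarrow> bool"
  where "jet \<tau> H x y \<longleftrightarrow>
    (\<exists>g. polynomial_map g \<and> (\<forall>s. H s = x + \<tau> s \<bullet> y + \<tau> s \<bullet> \<tau> s \<bullet> g s))"

lemma jetI: "polynomial_map g \<Longrightarrow> (\<And>s. H s = x + \<tau> s \<bullet> y + \<tau> s \<bullet> \<tau> s \<bullet> g s) \<Longrightarrow> jet \<tau> H x y"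
  by (auto simp: jet_def)

lemma jet_line: "jet \<tau> (\<lambda>s. a + \<tau> s \<bullet> z) a z"
  by (rule jetI[of "\<lambda>s. 0"]) (simp_all add: polynomial_map_const)

lemma jet_const: "jet \<tau> (\<lambda>s. a) a 0"
  by (rule jetI[of "\<lambda>s. 0"]) (simp_all add: polynomial_map_const)

lemma jet_diff:
  assumes "jet \<tau> H x x'" "jet \<tau> G y y'"
  shows "jet \<tau> (\<lambda>s. H s - G s) (x - y) (x' - y')"
proof -
  obtain g where g: "polynomial_map g" "H s = x + \<tau> s \<bullet> x' + \<tau> s \<bullet> \<tau> s \<bullet> g s" for s
    using assms(1) by (auto simp: jet_def)
  obtain f where f: "polynomial_map f" "G s = y + \<tau> s \<bullet> y' + \<tau> s \<bullet> \<tau> s \<bullet> f s" for s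
    using assms(2) by (auto simp: jet_def)
  show ?thesis
    by (rule jetI[of "\<lambda>s. g s - f s"])
      (simp_all add: polynomial_map_diff g f centroid_diff_right)
qed

lemma jet_mult:
  assumes \<tau>: "polynomial_map \<tau>" and "jet \<tau> H x x'" "jet \<tau> G y y'"
  shows "jet \<tau> (\<lambda>s. H s * G s) (x * y) (x * y' + x' * y)"
proof -
  obtain g where g: "polynomial_map g" "H s = x + \<tau> s \<bullet> x' + \<tau> s \<bullet> \<tau> s \<bullet> g s" for s
    using assms(2) by (auto simp: jet_def)
  obtain f where f: "polynomial_map f" "G s = y + \<tau> s \<bullet> y' + \<tau> s \<bullet> \<tau> s \<bullet> f s" for s
    using assms(3) by (auto simp: jet_def)
  show ?thesis
  proof (rule jetI[of "\<lambda>s. (x * f s + x' * y' + g s * y) + \<tau> s \<bullet> (x' * f s + g s * y' + \<tau> s \<bullet> (g s * f s))"])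
    show "polynomial_map (\<lambda>s. (x * f s + x' * y' + g s * y) + \<tau> s \<bullet> (x' * f s + g s * y' + \<tau> s \<bullet> (g s * f s)))"
      by (intro polynomial_map_add polynomial_map_app polynomial_map_mult polynomial_map_const \<tau> g(1) f(1))
  qed (simp add: g(2) f(2) distrib_left distrib_right centroid_mult_left centroid_mult_right
      centroid_add_right)
qed

lemma jet_power:
  assumes "polynomial_map \<tau>" "jet \<tau> H x x'"
  shows "jet \<tau> (\<lambda>s. ring_power (H s) k) (ring_power x k) (power_deriv x x' k)"
  by (induction k) (simp_all add: assms jet_mult)

text \<open>To first order, a + t [a, r] and b + t [b, r] are the images of a and b under an inner
  automorphism, so a polynomial expression in them changes by its bracket with
  \<open>r\<close>.\<close>

lemma jet_power_commutator:
  assumes "polynomial_map \<tau>"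
  shows "jet \<tau> (\<lambda>s. power_commutator k (a + \<tau> s \<bullet> lie a r) (b + \<tau> s \<bullet> lie b r))
    (power_commutator k a b) (lie (power_commutator k a b) r)"
proof -
  have ab: "jet \<tau> (\<lambda>s. ring_power ((a + \<tau> s \<bullet> lie a r) * (b + \<tau> s \<bullet> lie b r)) k)
    (ring_power (a * b) k) (lie (ring_power (a * b) k) r)" for a b
    using jet_power[OF assms jet_mult[OF assms jet_line jet_line], of a "lie a r" b "lie b r" k]
    by (simp flip: lie_mult_left power_deriv_lie)
  show ?thesis
    using jet_diff[OF ab ab, of a b b a] by (simp add: power_commutator_def lie_simps)
qed

text \<open>Stability under scalars allows division of \<open>H s - x\<close> by \<open>s\<close>;
  the quotient lies in \<open>P\<close> for nonzero \<open>s\<close>, and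
  \<open>polynomial_map_zero_mem\<close> extends this to 0.\<close>

lemma (in simple_rng) jet_coeff_mem:
  fixes P :: "'a set"
  assumes inf: "infinite (UNIV :: 'a centroid set)" and P: "add_subgroup P"
    and scale: "\<And>c x. x \<in> P \<Longrightarrow> c \<bullet> x \<in> P" and H: "jet (\<lambda>s. s) H x y" "\<And>s. H s \<in> P"
  shows "y \<in> P"
proof -
  obtain g where g: "polynomial_map g" "H s = x + s \<bullet> y + s \<bullet> s \<bullet> g s" for s
    using H(1) by (auto simp: jet_def)
  have x: "x \<in> P" using H(2)[of 0] g(2) by simp
  have "y + 0 \<bullet> g 0 \<in> P"
  proof (rule polynomial_map_zero_mem[OF inf P])
    show "polynomial_map (\<lambda>s. y + s \<bullet> g s)"
      by (intro polynomial_map_add polynomial_map_app polynomial_map_const polynomial_map_ident g(1))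
    fix s :: "'a centroid" assume "s \<noteq> 0"
    then obtain d where d: "d * s = 1" using centroid_inverse by blast
    have "d \<bullet> (H s - x) \<in> P" using scale add_subgroupD(2)[OF P H(2) x] by blast
    moreover have "d \<bullet> s \<bullet> z = z" for z using arg_cong[OF d, of "\<lambda>c. c \<bullet> z"] by simp
    ultimately show "y + s \<bullet> g s \<in> P" by (simp add: g(2) centroid_add_right)
  qed
  then show ?thesis by simp
qed

text \<open>Substituting \<open>s\<^sup>-\<^sup>1 (a + s\<^sup>n [a, r])\<close> and \<open>b + s\<^sup>n [b, r]\<close> makes the coefficient of interest the
  constant one.\<close>

lemma (in simple_rng) bracket_leading_mem:
  fixes A :: "'a set" and c :: "nat \<Rightarrow> 'a centroid"
  assumes inf: "infinite (UNIV :: 'a centroid set)" and A: "add_subgroup A"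
    and mem: "\<And>a b. (\<Sum>k<Suc m. c k \<bullet> power_commutator k a b) \<in> A" and cm: "c m \<noteq> 0"
  shows "lie (power_commutator m a b) r \<in> A"
proof -
  have main: "c m \<bullet> lie (power_commutator m a b) r \<in> A" for r
  proof -
    let ?n = "Suc m"
    let ?\<tau> = "\<lambda>s :: 'a centroid. s ^ ?n"
    let ?h = "\<lambda>k s. power_commutator k (a + ?\<tau> s \<bullet> lie a r) (b + ?\<tau> s \<bullet> lie b r)"
    let ?L = "\<lambda>k. lie (power_commutator k a b) r"
    have pt: "polynomial_map ?\<tau>" by (intro polynomial_map_power polynomial_map_ident)
    have "\<forall>k. \<exists>g. polynomial_map g \<and>
        (\<forall>s. ?h k s = power_commutator k a b + ?\<tau> s \<bullet> ?L k + ?\<tau> s \<bullet> ?\<tau> s \<bullet> g s)"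
      using jet_power_commutator[OF pt] unfolding jet_def by blast
    from choice[OF this] obtain g where g: "\<And>k. polynomial_map (g k)"
      "\<And>k s. ?h k s = power_commutator k a b + ?\<tau> s \<bullet> ?L k + ?\<tau> s \<bullet> ?\<tau> s \<bullet> g k s"
      by blast
    \<comment> \<open>Term \<open>k\<close> carries the inverse of s^(k+1) times s^(m+1), that is
      s^(m-k); at s = 0 only k = m survives. Terms of order zero are removed by subtracting the
      value at \<open>d \<bullet> a\<close> and \<open>b\<close>.\<close>
    let ?H = "\<lambda>s. \<Sum>k<?n. c k \<bullet> s ^ (m - k) \<bullet> (?L k + ?\<tau> s \<bullet> g k s)"
    have "?H 0 \<in> A"
    proof (rule polynomial_map_zero_mem[OF inf A])
      show "polynomial_map ?H"
        by (intro polynomial_map_sum polynomial_map_app polynomial_map_add polynomial_map_const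
            polynomial_map_power polynomial_map_ident g(1))
      fix s :: "'a centroid" assume "s \<noteq> 0"
      then obtain d where d: "d * s = 1" using centroid_inverse by blast
      have ds: "d ^ j * s ^ j = 1" for j
      proof (induction j)
        case (Suc j)
        have "d ^ Suc j * s ^ Suc j = d ^ j * (d * s) * s ^ j"
          by (simp only: power_Suc2[of d] power_Suc[of s] mult.assoc)
        then show ?case using Suc d by simp
      qed simp
      have "(\<Sum>k<?n. c k \<bullet> power_commutator k (d \<bullet> (a + ?\<tau> s \<bullet> lie a r)) (b + ?\<tau> s \<bullet> lie b r))
          - (\<Sum>k<?n. c k \<bullet> power_commutator k (d \<bullet> a) b) \<in> A"
        by (intro add_subgroupD(2)[OF A] mem)
      also have "(\<Sum>k<?n. c k \<bullet> power_commutator k (d \<bullet> (a + ?\<tau> s \<bullet> lie a r)) (b + ?\<tau> s \<bullet> lie b r))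
          - (\<Sum>k<?n. c k \<bullet> power_commutator k (d \<bullet> a) b)
        = (\<Sum>k<?n. c k \<bullet> d ^ Suc k \<bullet> (?h k s - power_commutator k a b))"
        unfolding sum_subtractf[symmetric] power_commutator_scale centroid_diff_right ..
      also have "\<dots> = ?H s"
      proof (rule sum.cong[OF refl])
        fix k assume "k \<in> {..<?n}"
        then have "?n = Suc k + (m - k)" by simp
        then have "d ^ Suc k * ?\<tau> s = s ^ (m - k)"
          by (metis ds mult.assoc mult_1 power_add)
        then have 1: "d ^ Suc k \<bullet> ?\<tau> s \<bullet> z = s ^ (m - k) \<bullet> z" for z
          by (metis centroid_app_simps(3))
        have "?h k s - power_commutator k a b = ?\<tau> s \<bullet> (?L k + ?\<tau> s \<bullet> g k s)"
          by (simp only: g(2) centroid_add_right) simp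
        then show "c k \<bullet> d ^ Suc k \<bullet> (?h k s - power_commutator k a b)
            = c k \<bullet> s ^ (m - k) \<bullet> (?L k + ?\<tau> s \<bullet> g k s)"
          by (simp only: 1)
      qed
      finally show "?H s \<in> A" .
    qed
    also have "?H 0 = (\<Sum>k<?n. if k = m then c m \<bullet> ?L m else 0)"
    proof (rule sum.cong[OF refl])
      have z: "(0 :: 'a centroid) ^ j = 0" if "j > 0" for j
        using that by (cases j) simp_all
      fix k assume "k \<in> {..<?n}"
      then show "c k \<bullet> 0 ^ (m - k) \<bullet> (?L k + ?\<tau> 0 \<bullet> g k 0) = (if k = m then c m \<bullet> ?L m else 0)"
        using z[of ?n] z[of "m - k"] by (auto simp del: power_Suc)
    qed
    finally show ?thesis by simp
  qed
  \<comment> \<open>The factor \<open>c m\<close> is absorbed into the arbitrary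
    \<open>r\<close>.\<close>
  obtain d where d: "c m * d = 1" using centroid_inverse cm by blast
  have "c m \<bullet> d \<bullet> z = z" for z using arg_cong[OF d, of "\<lambda>c. c \<bullet> z"] by simp
  then show ?thesis using main[of "d \<bullet> r"] by (simp add: centroid_lie)
qed

section \<open>Commutative Lie ideals and power-central rings\<close>

lemma identity_elementD: "identity_element e \<Longrightarrow> e * x = x" "identity_element e \<Longrightarrow> x * e = x"
  by (simp_all add: identity_element_def)

context simple_rng
begin

text \<open>Both x and [x, r] lie in \<open>T\<close>, so [x, [x, r]] = 0. On a product rs this
  leaves 2 [x, r][x, s] = 0; after division by 2, replacing s by sq gives [x, r] s [x, q] =
  0.\<close>

lemma commutative_lie_ideal_odd:
  assumes two: "(1 + 1 :: 'a centroid) \<noteq> 0" and T: "lie_ideal T"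
    and comm: "\<And>x y. x \<in> T \<Longrightarrow> y \<in> T \<Longrightarrow> lie x y = 0" and x: "x \<in> T"
  shows "central (x :: 'a)"
proof -
  have 0: "lie x (lie x r) = 0" for r
    using comm[OF x lie_idealD(1)[OF T x]] .
  have "(1 + 1) \<bullet> (lie x r * lie x s) = 0" for r s
    using 0[of "r * s"] 0[of r] 0[of s]
    by (simp add: lie_mult_right lie_simps centroid_add_left)
  then have 1: "lie x r * lie x s = 0" for r s
    using centroid_app_eq_0 two by blast
  have "lie x r * s * lie x q = 0" for r s q
    using 1[of r "s * q"] 1[of r s] by (simp add: lie_mult_right distrib_left mult.assoc[symmetric])
  then show ?thesis using prime unfolding central_def by blast
qed

text \<open>Multiplying the hypothesis by \<open>t\<close> gives trtrt = 0. Linearizing in r with s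
  t r as second argument gives (trt) s (trt) = 0, and primeness applies twice.\<close>

lemma square_zero_char2:
  fixes t :: 'a
  assumes t: "t * t = 0" and sq: "\<And>r. lie t r * lie t r = 0"
  shows "t = 0"
proof -
  have t': "t * (t * z) = 0" for z using t by (simp flip: mult.assoc)
  have 1: "t * r * t * r * t = 0" for r
  proof -
    have "t * (lie t r * lie t r) = t * r * t * r * t"
      by (simp add: lie_def algebra_simps t' t)
    then show ?thesis using sq by simp
  qed
  have 2: "t * r * t * s * t + t * s * t * r * t = 0" for r s
    using 1[of "r + s"] 1[of r] 1[of s] by (simp add: algebra_simps)
  have "(t * r * t) * s * (t * r * t) = 0" for r s
  proof -
    have "t * (s * t * r) * t * r * t = t * s * (t * r * t * r * t)" by (simp add: mult.assoc)
    then show ?thesis using 2[of r "s * t * r"] 1[of r] by (simp add: mult.assoc)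
  qed
  then have "t * r * t = 0" for r using prime by blast
  then show ?thesis using prime by blast
qed

text \<open>Squares of elements of \<open>T\<close> are central because [y^2, r] = 2 y [y, r] = 0.
  This provides the inverses from which the unit \<open>u\<close> is built.\<close>

lemma commutative_lie_ideal_char2:
  fixes T :: "'a set"
  assumes two: "\<And>z :: 'a. z + z = 0" and T: "is_subring T" "lie_ideal T"
    and comm: "\<And>x y. x \<in> T \<Longrightarrow> y \<in> T \<Longrightarrow> lie x y = 0"
    and conj: "\<And>e u v x. identity_element e \<Longrightarrow> u * v = e \<Longrightarrow> v * u = e \<Longrightarrow> x \<in> T \<Longrightarrow> u * x * v \<in> T"
    and x: "x \<in> T"
  shows "central x"
proof (rule ccontr)
  assume "\<not> central x"
  then obtain r0 where r0: "lie x r0 \<noteq> 0" by (auto simp: central_def)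
  note d = add_subgroupD[OF lie_ideal_add_subgroup[OF T(2)]]
  have sq: "central (y * y)" if "y \<in> T" for y
  proof -
    have "lie (y * y) r = 0" for r
    proof -
      have "y * lie y r = lie y r * y"
        using comm[OF that lie_idealD(1)[OF T(2) that]] by (simp add: lie_eq_0_iff)
      then show ?thesis by (simp add: lie_mult_left two)
    qed
    then show ?thesis by (simp add: central_def)
  qed
  \<comment> \<open>Take x1 = x, or x1 = [x, r0] if all [x, r] have square zero;
    \<open>square_zero_char2\<close> excludes failure of both.\<close>
  have "\<exists>x1\<in>T. \<exists>r. lie x1 r * lie x1 r \<noteq> 0"
    using square_zero_char2[of "lie x r0"] r0 x lie_idealD(1)[OF T(2) x] by metis
  then obtain x1 r where x1: "x1 \<in> T" and xr: "lie x1 r * lie x1 r \<noteq> 0" by blast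
  define q where "q = lie x1 r"
  have qT: "q \<in> T" using x1 lie_idealD(1)[OF T(2)] by (simp add: q_def)
  obtain e z' where e: "identity_element e" and z': "central z'" "z' * (q * q) = e"
    using central_unit[OF sq[OF qT]] xr q_def by blast
  note e1 = identity_elementD[OF e]
  \<comment> \<open>\<open>z' * q\<close> is the inverse of \<open>q\<close> and commutes with
    \<open>x1\<close>; it normalizes [x1, r] = q to the identity.\<close>
  define r' where "r' = z' * q * r"
  have xq: "lie x1 (z' * q) = 0"
    using comm[OF x1 qT] z'(1) lie_skew[of x1 z'] by (simp add: lie_mult_right central_def)
  have r': "lie x1 r' = e"
    unfolding r'_def lie_mult_right[of x1 "z' * q"] xq
    using z'(2) by (simp add: mult.assoc q_def)
  \<comment> \<open>[x1, s r'] = s if \<open>s\<close> commutes with \<open>x1\<close>, so the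
    centralizer of \<open>x1\<close> lies in \<open>T\<close>. It contains the square of r', whose
    fourth power is therefore central.\<close>
  have cent: "s \<in> T" if "lie x1 s = 0" for s
    using lie_idealD(1)[OF T(2) x1, of "s * r'"] by (simp add: lie_mult_right that r' e1)
  have "lie x1 (r' * r') = 0" by (simp add: lie_mult_right r' e1 two)
  then have c4: "central ((r' * r') * (r' * r'))" using sq cent by blast
  have e0: "e \<noteq> 0"
  proof
    assume "e = 0"
    then have "z = 0" for z :: 'a using e1(1)[of z] by simp
    then show False using r0 by blast
  qed
  have xe: "lie x1 e = 0" by (simp add: lie_def e1)
  \<comment> \<open>If the fourth power of r' is 0, that of r' + e is e in characteristic 2; so one
    of the two is a unit.\<close>
  obtain u where u: "lie x1 u = e" "central ((u * u) * (u * u))" "(u * u) * (u * u) \<noteq> 0"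
  proof (cases "(r' * r') * (r' * r') = 0")
    case False
    then show ?thesis using that[of r'] r' c4 by blast
  next
    case True
    have "(r' + e) * (r' + e) = r' * r' + e + (r' + r')"
      by (simp add: algebra_simps e1)
    then have 1: "(r' + e) * (r' + e) = r' * r' + e" by (simp add: two)
    have "(r' * r' + e) * (r' * r' + e) = e + (r' * r' + r' * r')"
      using True by (simp add: algebra_simps e1)
    then have 2: "((r' + e) * (r' + e)) * ((r' + e) * (r' + e)) = e"
      unfolding 1 by (simp add: two)
    have "central e" by (simp add: central_def lie_def e1)
    then show ?thesis using that[of "r' + e"] 2 e0 r' xe by (simp add: lie_simps)
  qed
  obtain e2 w' where e2: "identity_element e2" and w': "central w'" "w' * ((u * u) * (u * u)) = e2"
    using central_unit[OF u(2,3)] .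
  have "e2 = e" using identity_elementD[OF e2, of e] e1[of e2] by simp
  define v where "v = w' * (u * u * u)"
  have uv: "u * v = e" "v * u = e"
    using w'(2) \<open>e2 = e\<close> centralD[OF w'(1), of u] unfolding v_def
    by (simp_all add: mult.assoc) (metis mult.assoc)
  have ux: "u * x1 = x1 * u - e" using u(1) by (simp add: lie_def algebra_simps)
  have "u * x1 * v = x1 - v"
    unfolding ux by (simp add: left_diff_distrib mult.assoc uv e1)
  then have "v \<in> T" using d(2)[OF x1 conj[OF e uv x1]] by simp
  then have "x1 * v = v * x1" using comm[OF x1] by (simp add: lie_eq_0_iff)
  then have "u * (x1 * v) * u = u * (v * x1) * u" by simp
  then have "u * x1 = x1 * u"
    by (simp add: mult.assoc uv e1) (metis e1(1) mult.assoc uv(1))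
  then show False using u(1) e0 by (simp add: lie_def)
qed

text \<open>For \<open>y = a r\<close> and \<open>w = y\<^sup>k\<^sup>+\<^sup>1 a\<close> the linear coefficient of \<open>(y + t w s)\<^sup>k\<^sup>+\<^sup>2 a\<close> is \<open>w s w\<close>,
  because \<open>y w = 0\<close>.\<close>

lemma levitzki_step:
  fixes a :: 'a
  assumes inf: "infinite (UNIV :: 'a centroid set)"
    and nil: "\<And>r. ring_power (a * r) (Suc k) * a = 0"
  shows "ring_power (a * r) k * a = 0"
proof (rule ccontr)
  define y where "y = a * r"
  define w where "w = ring_power y k * a"
  assume "ring_power (a * r) k * a \<noteq> 0"
  then have w: "w \<noteq> 0" by (simp add: w_def y_def)
  have yw: "y * w = 0" using nil[of r] by (simp add: w_def y_def mult.assoc)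
  \<comment> \<open>The left factor \<open>a\<close> keeps y + t w s in a R, where the hypothesis
    applies.\<close>
  have "\<exists>w1. w = a * w1"
  proof (cases k)
    case 0
    then have "w = a * (r * a)" by (simp add: w_def y_def mult.assoc)
    then show ?thesis ..
  next
    case (Suc j)
    then have "w = a * (r * (ring_power y j * a))" by (simp add: w_def y_def mult.assoc)
    then show ?thesis ..
  qed
  then obtain w1 where w1: "w = a * w1" ..
  have "w * s * w = 0" for s
  proof -
    let ?z = "w * s"
    have yz: "y * ?z = 0" using yw by (simp flip: mult.assoc)
    have eq: "y + t \<bullet> ?z = a * (r + t \<bullet> (w1 * s))" for t
      by (simp add: y_def w1 distrib_left centroid_mult_right mult.assoc)
    have "jet (\<lambda>s. s) (\<lambda>t. ring_power (y + t \<bullet> ?z) (Suc k) * a)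
      (ring_power y (Suc k) * a) (ring_power y (Suc k) * 0 + power_deriv y ?z (Suc k) * a)"
      by (intro jet_mult jet_power polynomial_map_ident jet_const) (rule jet_line)
    then have "ring_power y (Suc k) * 0 + power_deriv y ?z (Suc k) * a \<in> {0}"
      by (rule jet_coeff_mem[OF inf, rotated 2]) (simp_all only: eq nil, simp_all add: add_subgroup_def)
    then have "power_deriv y ?z (Suc k) * a = 0" by simp
    moreover have "y * power_deriv y ?z j = 0" for j
    proof (induction j)
      case (Suc j)
      have "y * power_deriv y ?z (Suc j) = y * (y * power_deriv y ?z j) + y * ?z * ring_power y j"
        by (simp add: distrib_left mult.assoc)
      then show ?case using Suc yz by simp
    qed (use yz in simp)
    ultimately show ?thesis by (simp add: w_def mult.assoc)
  qed
  then show False using prime w by blast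
qed

text \<open>A right ideal of bounded nil exponent vanishes: \<open>levitzki_step\<close> lowers the
  exponent until a r a = 0 for all r.\<close>

lemma levitzki:
  fixes a :: 'a
  assumes inf: "infinite (UNIV :: 'a centroid set)" and nil: "\<And>r. ring_power (a * r) k = 0"
  shows "a = 0"
proof -
  have "(\<forall>r. ring_power (a * r) j * a = 0) \<Longrightarrow> a = 0" for j
  proof (induction j)
    case 0
    then show ?case using prime[of a a] by simp
  next
    case (Suc j)
    then show ?case using levitzki_step[OF inf, of a j] by blast
  qed
  from this[of k] show ?thesis using nil by simp
qed

text \<open>If a^(N+1) is nonzero, it is a central unit, so a is a unit. If it is 0, no ar is a
  unit, since otherwise a and its powers would be right invertible; so (ar)^(N+1) = 0 for all r and
  \<open>levitzki\<close> gives a = 0.\<close>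

lemma power_central_division:
  assumes inf: "infinite (UNIV :: 'a centroid set)" and pc: "\<And>a :: 'a. central (ring_power a (Suc N))"
  obtains e :: 'a where "identity_element e" "\<And>a. a \<noteq> 0 \<Longrightarrow> \<exists>b. a * b = e \<and> b * a = e"
proof -
  have inv: "\<exists>b e. identity_element e \<and> a * b = e \<and> b * a = e"
    if nz: "ring_power a (Suc N) \<noteq> 0" for a :: 'a
  proof -
    obtain e z where e: "identity_element e" and z: "central z" "z * ring_power a (Suc N) = e"
      using central_unit[OF pc nz] .
    have "a * (z * ring_power a N) = z * (a * ring_power a N)"
      using centralD[OF z(1), of a] by (simp flip: mult.assoc)
    moreover have "z * ring_power a N * a = z * (a * ring_power a N)"
      by (simp add: mult.assoc ring_power_commute)
    ultimately have "a * (z * ring_power a N) = e" "z * ring_power a N * a = e"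
      using z(2) by simp_all
    then show ?thesis using e by blast
  qed
  have unique: "e = e'" if e: "identity_element e" "identity_element e'" for e e' :: 'a
    using identity_elementD(1)[OF e(1), of e'] identity_elementD(2)[OF e(2), of e] by simp
  have nz: "ring_power a (Suc N) \<noteq> 0" if "a \<noteq> 0" for a :: 'a
  proof
    assume 0: "ring_power a (Suc N) = 0"
    have "ring_power (a * r) (Suc N) = 0" for r
    proof (rule ccontr)
      assume "ring_power (a * r) (Suc N) \<noteq> 0"
      then obtain b e where e: "identity_element e" "a * r * b = e"
        using inv by blast
      note e1 = identity_elementD[OF e(1)]
      have "\<exists>c. ring_power a j * c = e" for j
      proof (induction j)
        case 0
        have "ring_power a 0 * (r * b) = e" using e(2) by (simp add: mult.assoc)
        then show ?case ..
      next
        case (Suc j)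
        then obtain c where c: "ring_power a j * c = e" ..
        have "ring_power a (Suc j) * (c * (r * b)) = a * (ring_power a j * c) * (r * b)"
          by (simp add: mult.assoc)
        also have "\<dots> = a * (r * b)" by (simp only: c e1 mult.assoc)
        also have "\<dots> = e" using e(2) by (simp only: mult.assoc)
        finally show ?case ..
      qed
      then obtain c where "ring_power a (Suc N) * c = e" by blast
      then have "e = 0" unfolding 0 by simp
      then show False using e1(1)[of a] that by simp
    qed
    then show False using levitzki[OF inf] that by blast
  qed
  obtain x y :: 'a where "x * y \<noteq> 0" using square_nonzero by blast
  then have "x \<noteq> 0" by auto
  then obtain e :: 'a where e: "identity_element e" using inv[OF nz] by blast
  show thesis
  proof (rule that[OF e])
    fix a :: 'a assume "a \<noteq> 0"
    then show "\<exists>b. a * b = e \<and> b * a = e" using inv[OF nz] unique[OF e] by blast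
  qed
qed

text \<open>The constant coefficient is the value at 0. The rest is divided by nonzero t, and
  \<open>polynomial_map_zero_mem\<close> supplies the value of the quotient at 0.\<close>

lemma polynomial_coeffs_mem:
  fixes P :: "'a set"
  assumes inf: "infinite (UNIV :: 'a centroid set)" and P: "add_subgroup P"
    and scale: "\<And>c x. x \<in> P \<Longrightarrow> c \<bullet> x \<in> P"
  shows "(\<And>t :: 'a centroid. (\<Sum>i\<le>m. t ^ i \<bullet> v i) \<in> P) \<Longrightarrow> i \<le> m \<Longrightarrow> v i \<in> P"
proof (induction m arbitrary: v i)
  case 0
  then show ?case by simp
next
  case (Suc m)
  have eq: "(\<Sum>i\<le>Suc m. t ^ i \<bullet> v i) = v 0 + t \<bullet> (\<Sum>i\<le>m. t ^ i \<bullet> v (Suc i))" for t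
    unfolding sum.atMost_Suc_shift by (simp add: centroid_sum_right)
  have v0: "v 0 \<in> P" using Suc.prems(1)[of 0] unfolding eq by simp
  let ?H = "\<lambda>t. \<Sum>i\<le>m. t ^ i \<bullet> v (Suc i)"
  have pH: "polynomial_map ?H"
    by (intro polynomial_map_sum polynomial_map_app polynomial_map_power polynomial_map_ident
        polynomial_map_const)
  have 1: "?H t \<in> P" if t: "t \<noteq> 0" for t
  proof -
    obtain d where d: "d * t = 1" using centroid_inverse[OF t] by blast
    have "d \<bullet> ((\<Sum>i\<le>Suc m. t ^ i \<bullet> v i) - v 0) \<in> P"
      by (intro scale add_subgroupD(2)[OF P] Suc.prems(1) v0)
    moreover have "d \<bullet> t \<bullet> z = z" for z using arg_cong[OF d, of "\<lambda>c. c \<bullet> z"] by simp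
    ultimately show ?thesis unfolding eq by simp
  qed
  have H: "?H t \<in> P" for t
  proof (cases "t = 0")
    case True
    show ?thesis unfolding True by (rule polynomial_map_zero_mem[OF inf P pH 1])
  next
    case False
    then show ?thesis by (rule 1)
  qed
  show ?case
  proof (cases i)
    case 0
    then show ?thesis using v0 by simp
  next
    case (Suc j)
    then show ?thesis using Suc.IH[of "\<lambda>i. v (Suc i)" j, OF H] Suc.prems(2) by simp
  qed
qed

end

text \<open>Binomial coefficients inside the centroid; the library version needs a semiring with
  \<open>0 \<noteq> 1\<close>.\<close>

primrec cbinom :: "nat \<Rightarrow> nat \<Rightarrow> 'a::ring centroid"
  where
    "cbinom 0 i = (if i = 0 then 1 else 0)"
  | "cbinom (Suc m) i = (case i of 0 \<Rightarrow> cbinom m 0 | Suc j \<Rightarrow> cbinom m j + cbinom m (Suc j))"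

lemma cbinom_0: "cbinom m 0 = 1"
  by (induction m) simp_all

lemma cbinom_gt: "m < i \<Longrightarrow> cbinom m i = 0"
  by (induction m arbitrary: i) (auto split: nat.split)

lemma cbinom_self: "cbinom m m = 1"
  by (induction m) (simp_all add: cbinom_gt)

text \<open>Stated for commuting operators, because it is applied to multiplications, an inner
  derivation, a scalar and the identity map.\<close>

lemma funpow_binomial:
  fixes f g :: "'a::ring \<Rightarrow> 'a"
  assumes f: "\<And>x y. f (x + y) = f x + f y" "\<And>c x. f (c \<bullet> x) = c \<bullet> f x"
    and g: "\<And>x y. g (x + y) = g x + g y" "\<And>c x. g (c \<bullet> x) = c \<bullet> g x"
    and fg: "\<And>x. f (g x) = g (f x)"
  shows "((\<lambda>x. f x + g x) ^^ m) x = (\<Sum>i\<le>m. cbinom m i \<bullet> (g ^^ i) ((f ^^ (m - i)) x))"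
proof (induction m)
  case 0
  then show ?case by simp
next
  case (Suc m)
  let ?t = "\<lambda>m i. (g ^^ i) ((f ^^ (m - i)) x)"
  have fgi: "f ((g ^^ i) z) = (g ^^ i) (f z)" for i z
    by (induction i) (simp_all add: fg)
  have "((\<lambda>x. f x + g x) ^^ Suc m) x
    = (\<Sum>i\<le>m. cbinom m i \<bullet> f (?t m i)) + (\<Sum>i\<le>m. cbinom m i \<bullet> g (?t m i))"
    by (simp add: Suc f g additive_minus_zero(4)[of f, OF f(1)] additive_minus_zero(4)[of g, OF g(1)])
  also have "(\<Sum>i\<le>m. cbinom m i \<bullet> f (?t m i)) = (\<Sum>i\<le>m. cbinom m i \<bullet> ?t (Suc m) i)"
    by (intro sum.cong refl) (simp add: fgi Suc_diff_le)
  also have "\<dots> = (\<Sum>i\<le>Suc m. cbinom m i \<bullet> ?t (Suc m) i)"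
    by (simp add: cbinom_gt)
  also have "\<dots> = ?t (Suc m) 0 + (\<Sum>i\<le>m. cbinom m (Suc i) \<bullet> ?t (Suc m) (Suc i))"
    unfolding sum.atMost_Suc_shift by (simp add: cbinom_0)
  also have "(\<Sum>i\<le>m. cbinom m i \<bullet> g (?t m i)) = (\<Sum>i\<le>m. cbinom m i \<bullet> ?t (Suc m) (Suc i))"
    by simp
  also have "?t (Suc m) 0 + (\<Sum>i\<le>m. cbinom m (Suc i) \<bullet> ?t (Suc m) (Suc i))
      + (\<Sum>i\<le>m. cbinom m i \<bullet> ?t (Suc m) (Suc i))
    = ?t (Suc m) 0 + (\<Sum>i\<le>m. cbinom (Suc m) (Suc i) \<bullet> ?t (Suc m) (Suc i))"
    by (simp add: centroid_add_left sum.distrib)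
  also have "\<dots> = (\<Sum>i\<le>Suc m. cbinom (Suc m) i \<bullet> ?t (Suc m) i)"
    unfolding sum.atMost_Suc_shift by (simp add: cbinom_0)
  finally show ?case .
qed

context simple_rng
begin

text \<open>With minimal exponent all interior binomial coefficients vanish, so that \<open>x \<mapsto> x\<^sup>m\<close> is
  additive on commuting elements; then a noncentral \<open>a\<close> has nilpotent inner derivation, which yields
  \<open>y\<close> with \<open>a y a\<^sup>-\<^sup>1 = y + 1\<close>, although \<open>y\<^sup>m\<close> is central.\<close>

lemma power_central_commutative:
  assumes inf: "infinite (UNIV :: 'a centroid set)" and pc: "\<And>a :: 'a. central (ring_power a (Suc N))"
  shows "central (a :: 'a)"
proof (rule ccontr)
  assume a: "\<not> central a"
  obtain e :: 'a where e: "identity_element e"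
    and inv: "\<And>a. a \<noteq> 0 \<Longrightarrow> \<exists>b. a * b = e \<and> b * a = e"
    using power_central_division[OF inf pc] by blast
  note e1 = identity_elementD[OF e]
  define k where "k = (LEAST k. \<forall>a :: 'a. central (ring_power a k))"
  have k: "central (ring_power x k)" for x :: 'a
    using LeastI[of "\<lambda>k. \<forall>a :: 'a. central (ring_power a k)" "Suc N"] pc unfolding k_def by blast
  have k_min: "\<exists>x :: 'a. \<not> central (ring_power x j)" if "j < k" for j
    using not_less_Least[of j "\<lambda>k. \<forall>a :: 'a. central (ring_power a k)"] that unfolding k_def by blast
  have k0: "k \<noteq> 0" using k[of a] a by (cases k) auto
  let ?m = "Suc k"
  \<comment> \<open>In the central element (y + t e)^m the coefficient of t^i is
    \<open>cbinom ?m i\<close> times y^(m-i). Were the binomial coefficient nonzero, all y^(m-i)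
    would be central, against minimality.\<close>
  have vanish: "cbinom ?m i = (0 :: 'a centroid)" if i: "0 < i" "i < ?m" for i
  proof (rule ccontr)
    assume nz: "cbinom ?m i \<noteq> (0 :: 'a centroid)"
    have "central (ring_power y (k - i))" for y :: 'a
    proof -
      let ?f = "\<lambda>x. y * x"
      have "(\<Sum>i\<le>?m. t ^ i \<bullet> cbinom ?m i \<bullet> (?f ^^ (?m - i)) e) \<in> {x. central x}" for t
      proof -
        have gi: "((\<lambda>x. t \<bullet> x) ^^ i) z = t ^ i \<bullet> z" for i and z :: 'a
          by (induction i) simp_all
        have sh: "(\<lambda>x. y * x + t \<bullet> x) = (\<lambda>x. (y + t \<bullet> e) * x)"
          by (simp add: distrib_right centroid_mult_left e1 fun_eq_iff)
        have "((\<lambda>x. y * x + t \<bullet> x) ^^ ?m) e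
          = (\<Sum>i\<le>?m. cbinom ?m i \<bullet> ((\<lambda>x. t \<bullet> x) ^^ i) ((?f ^^ (?m - i)) e))"
          by (rule funpow_binomial)
            (simp_all add: distrib_left centroid_mult_right centroid_add_right,
              metis centroid_commute centroid_app_simps(3))
        also have "((\<lambda>x. y * x + t \<bullet> x) ^^ ?m) e = ring_power (y + t \<bullet> e) k"
          unfolding sh ring_power_eq_funpow[symmetric] by (rule e1)
        finally have eq: "ring_power (y + t \<bullet> e) k
            = (\<Sum>i\<le>?m. cbinom ?m i \<bullet> t ^ i \<bullet> (?f ^^ (?m - i)) e)"
          unfolding gi .
        have "cbinom ?m i \<bullet> t ^ i \<bullet> z = t ^ i \<bullet> cbinom ?m i \<bullet> z" for i and z :: 'a
          by (metis centroid_commute centroid_app_simps(3))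
        then show ?thesis using k[of "y + t \<bullet> e"] unfolding eq by simp
      qed
      then have "cbinom ?m i \<bullet> (?f ^^ (?m - i)) e \<in> {x. central x}"
        by (rule polynomial_coeffs_mem[OF inf add_subgroup_central _ _ less_imp_le[OF i(2)], rotated])
          (simp add: central_def centroid_lie)
      moreover have "(?f ^^ (?m - i)) e = ring_power y (k - i)"
      proof -
        have "?m - i = Suc (k - i)" using i by simp
        then show ?thesis by (simp only: ring_power_eq_funpow[symmetric] e1)
      qed
      ultimately show ?thesis
        using nz centroid_app_eq_0 unfolding central_def by (auto simp: centroid_lie)
    qed
    then show False using k_min[of "k - i"] i k0 by auto
  qed
  have binom: "((\<lambda>x. f x + g x) ^^ ?m) x = (f ^^ ?m) x + (g ^^ ?m) x"
    if "\<And>x y. f (x + y) = f x + f y" "\<And>c x. f (c \<bullet> x) = c \<bullet> f x"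
      "\<And>x y. g (x + y) = g x + g y" "\<And>c x. g (c \<bullet> x) = c \<bullet> g x" "\<And>x. f (g x) = g (f x)"
    for f g :: "'a \<Rightarrow> 'a" and x
  proof -
    have "(\<Sum>i\<le>?m. cbinom ?m i \<bullet> (g ^^ i) ((f ^^ (?m - i)) x))
        = (\<Sum>i\<in>{0, ?m}. cbinom ?m i \<bullet> (g ^^ i) ((f ^^ (?m - i)) x))"
      by (rule sum.mono_neutral_right) (auto simp: vanish simp del: cbinom.simps)
    then show ?thesis
      unfolding funpow_binomial[of f g, OF that]
      by (simp add: cbinom_0 cbinom_self del: cbinom.simps funpow.simps)
  qed
  let ?d = "lie a"
  have L: "((\<lambda>x. a * x) ^^ ?m) x = ring_power a k * x" for x
    by (rule ring_power_eq_funpow[symmetric])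
  have R: "((\<lambda>x. x * a) ^^ Suc j) x = x * ring_power a j" for x j
    by (induction j) (simp_all add: mult.assoc ring_power_commute)
  \<comment> \<open>Left multiplication by \<open>a\<close> is the sum of the inner derivation and
    right multiplication, which commute. As a^m is central, additivity makes the m-th power of the
    derivation 0.\<close>
  have "((\<lambda>x. ?d x + x * a) ^^ ?m) x = (?d ^^ ?m) x + ((\<lambda>x. x * a) ^^ ?m) x" for x
    by (rule binom) (simp_all add: lie_simps centroid_lie distrib_right centroid_mult_left lie_mult_right)
  moreover have "(\<lambda>x. ?d x + x * a) = (\<lambda>x. a * x)" by (simp add: lie_def fun_eq_iff)
  ultimately have dm: "(?d ^^ ?m) x = 0" for x
    using L[of x] R[of k x] centralD[OF k[of a], of x] by (simp del: funpow.simps)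
  obtain x where x: "?d x \<noteq> 0" using a by (auto simp: central_def)
  \<comment> \<open>The last stages before the derivation kills \<open>x\<close> give
    \<open>c\<close> with [a, c] nonzero and [a, [a, c]] = 0.\<close>
  define j where "j = (LEAST j. (?d ^^ j) x = 0)"
  have j: "(?d ^^ j) x = 0" unfolding j_def by (rule LeastI[of "\<lambda>j. (?d ^^ j) x = 0", OF dm])
  have "j \<noteq> 0" using j x by (cases j) (auto simp: lie_simps)
  moreover have "j \<noteq> 1" using j x by auto
  ultimately obtain i where i: "j = Suc (Suc i)" by (metis One_nat_def not0_implies_Suc)
  define c where "c = (?d ^^ i) x"
  have dc: "?d c \<noteq> 0"
    using not_less_Least[of "Suc i" "\<lambda>j. (?d ^^ j) x = 0"] i unfolding j_def c_def by simp
  have ddc: "?d (?d c) = 0" using j i by (simp add: c_def)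
  obtain u where u: "?d c * u = e" "u * ?d c = e" using inv[OF dc] by blast
  have du: "?d u = 0"
  proof -
    have "a * ?d c = ?d c * a" using ddc by (simp add: lie_eq_0_iff)
    then have "u * (a * ?d c) * u = u * (?d c * a) * u" by simp
    then have "u * a = a * u" by (metis e1 mult.assoc u)
    then show ?thesis by (simp add: lie_eq_0_iff)
  qed
  \<comment> \<open>\<open>u\<close> inverts [a, c] and commutes with a, so [a, y] = u [a, c] a = a,
    that is a y = (y + e) a. Then a y^m = (y + e)^m a = y^m a + a, although y^m is central.\<close>
  define y where "y = u * c * a"
  have "?d y = a" by (simp add: y_def lie_mult_right du u e1 lie_simps)
  then have ay: "a * y = y * a + a" by (simp add: lie_def algebra_simps)
  have "a * ((\<lambda>z. y * z) ^^ j) z = ((\<lambda>z. y * z + z) ^^ j) (a * z)" for j z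
  proof (induction j)
    case (Suc j)
    have "a * (y * w) = y * (a * w) + a * w" for w
      by (simp add: ay distrib_right flip: mult.assoc)
    then show ?case using Suc by simp
  qed simp
  from this[of ?m e] have "a * ring_power y k = ((\<lambda>z. y * z + z) ^^ ?m) a"
    by (simp only: ring_power_eq_funpow[symmetric] e1)
  also have "\<dots> = ((\<lambda>z. y * z) ^^ ?m) a + ((\<lambda>z. z) ^^ ?m) a"
    by (rule binom) (simp_all add: distrib_left centroid_mult_right)
  also have "\<dots> = ring_power y k * a + a"
    by (simp only: ring_power_eq_funpow[symmetric]) (simp add: id_def[symmetric])
  finally have "a = 0" using centralD[OF k[of y], of a] by simp
  then show False using a by (simp add: central_def lie_simps)
qed

text \<open>With b = a + s c the linear coefficient is D [a, c], where D is the derivative of the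
  power at a^2. Both this and D [a, ca] = D [a, c] a are central, so D [a, c] = 0 for noncentral a;
  then [a^(2m+2), c] = D [a^2, c] = 0.\<close>

lemma power_commutator_not_central:
  assumes inf: "infinite (UNIV :: 'a centroid set)" and nc: "x * y \<noteq> y * (x :: 'a)"
  shows "\<exists>a b :: 'a. \<not> central (power_commutator m a b)"
proof (rule ccontr)
  assume "\<not> ?thesis"
  then have pc: "central (power_commutator m a b)" for a b :: 'a by blast
  have "central (ring_power a (2 * m + 1))" for a :: 'a
  proof (cases "central a")
    case True
    then show ?thesis
      using ring_power_commute[of _ a "2 * m + 1"] unfolding central_def lie_eq_0_iff by metis
  next
    case False
    let ?D = "\<lambda>w. power_deriv (a * a) w m"
    have ay: "a * (a * a) = (a * a) * a" by (simp add: mult.assoc)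
    have cD: "central (?D (lie a c))" for c
    proof -
      have "jet (\<lambda>s. s) (\<lambda>s. a * (a + s \<bullet> c)) (a * a) (a * c + 0 * a)"
        "jet (\<lambda>s. s) (\<lambda>s. (a + s \<bullet> c) * a) (a * a) (a * 0 + c * a)"
        by (intro jet_mult polynomial_map_ident jet_const; rule jet_line)+
      from jet_diff[OF this[THEN jet_power[OF polynomial_map_ident, where k = m]]]
      have "jet (\<lambda>s. s) (\<lambda>s. power_commutator m a (a + s \<bullet> c)) 0 (?D (lie a c))"
        by (simp add: power_commutator_def power_deriv_diff[symmetric] lie_def)
      then have "?D (lie a c) \<in> {x. central x}"
        by (rule jet_coeff_mem[OF inf add_subgroup_central, rotated])
          (use pc in \<open>auto simp: central_def centroid_lie\<close>)
      then show ?thesis by simp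
    qed
    have D0: "?D (lie a c) = 0" for c
    proof -
      have "?D (lie a (c * a)) = ?D (lie a c) * a"
        unfolding power_deriv_mult_right[OF ay, symmetric] by (simp add: lie_mult_right lie_simps)
      then show ?thesis using central_mult_central[OF cD] cD[of "c * a"] False by metis
    qed
    have c0: "lie (ring_power (a * a) m) c = 0" for c
      unfolding power_deriv_lie[symmetric] lie_mult_left power_deriv_add
        power_deriv_mult_left[OF ay] power_deriv_mult_right[OF ay] D0 by simp
    show ?thesis
      using c0 unfolding central_def ring_power_double by blast
  qed
  then have "central x" using power_central_commutative[OF inf, of "2 * m"] by simp
  then show False using nc centralD by metis
qed

section \<open>Conclusion for an infinite centroid\<close>

lemma commutator_group_subset_infinite_centroid:
  fixes A :: "'a set" and c :: "nat \<Rightarrow> 'a centroid"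
  assumes inf: "infinite (UNIV :: 'a centroid set)" and nc: "x * y \<noteq> y * (x :: 'a)"
    and A: "add_subgroup A"
    and mem: "\<And>a b. (\<Sum>k<Suc m. c k \<bullet> power_commutator k a b) \<in> A" and cm: "c m \<noteq> 0"
  shows "commutator_group \<subseteq> A"
proof -
  let ?X = "{t \<bullet> power_commutator m a b | t (a :: 'a) b. True}"
  define P where "P = group_closure ?X"
  have P: "add_subgroup P" by (simp add: P_def)
  have gen: "t \<bullet> power_commutator m a b \<in> P" for t a b
    unfolding P_def by (rule group_closure.base) blast
  have gen1: "power_commutator m a b \<in> P" for a b using gen[of 1] by simp
  have ind: "z \<in> S" if "z \<in> P" "add_subgroup S" "\<And>t a b. t \<bullet> power_commutator m a b \<in> S" for z S
    using that group_closure_least[of S ?X] unfolding P_def by blast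
  have scale: "s \<bullet> z \<in> P" if "z \<in> P" for s z
  proof -
    have "z \<in> {z. s \<bullet> z \<in> P}"
      by (rule ind[OF that])
        (use add_subgroupD[OF P] gen[of "s * t" for t] in \<open>auto simp: add_subgroup_def centroid_diff_right\<close>)
    then show ?thesis by simp
  qed
  have PL: "lie_ideal P"
    unfolding lie_ideal_def
  proof (intro conjI ballI allI P)
    fix z r assume z: "z \<in> P"
    have "lie (power_commutator m a b) r \<in> P" for a b
      by (rule jet_coeff_mem[OF inf P scale jet_power_commutator[OF polynomial_map_ident] gen1])
    then have "z \<in> {z. lie z r \<in> P}"
      by (intro ind[OF z])
        (use add_subgroupD[OF P] scale in \<open>auto simp: add_subgroup_def lie_simps centroid_lie\<close>)
    then show "lie z r \<in> P" by simp
  qed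
  have PA: "lie z r \<in> A" if "z \<in> P" for z r
  proof -
    have "lie (t \<bullet> power_commutator m a b) r \<in> A" for t a b
      using bracket_leading_mem[OF inf A mem cm, of a b "t \<bullet> r"] by (simp add: centroid_lie)
    then have "z \<in> {z. lie z r \<in> A}"
      by (intro ind[OF that]) (use add_subgroupD[OF A] in \<open>auto simp: add_subgroup_def lie_simps\<close>)
    then show ?thesis by simp
  qed
  let ?T = "transporter P"
  have T: "is_subring ?T" "lie_ideal ?T"
    using transporter_subring[OF P] transporter_lie_ideal[OF PL] .
  have "\<exists>u\<in>?T. \<exists>v\<in>?T. lie u v \<noteq> 0"
  proof (rule ccontr)
    assume "\<not> ?thesis"
    then have comm: "lie u v = 0" if "u \<in> ?T" "v \<in> ?T" for u v using that by blast
    have "central z" if z: "z \<in> ?T" for z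
    proof (cases "(1 + 1 :: 'a centroid) = 0")
      case False
      then show ?thesis using commutative_lie_ideal_odd[OF _ T(2) comm z] by blast
    next
      case True
      have two: "z + z = 0" for z :: 'a
        using arg_cong[OF True, of "\<lambda>c. c \<bullet> z"] by (simp add: centroid_add_left)
      have conj: "u * z * v \<in> ?T"
        if e: "identity_element e" and uv: "u * v = e" "v * u = e" and z: "z \<in> ?T" for e u v z
      proof -
        note e1 = identity_elementD[OF e]
        let ?s = "\<lambda>z. u * z * v"
        have sm: "?s (p * q) = ?s p * ?s q" for p q
          by (metis e1(1) mult.assoc uv(2))
        have sd: "?s (p - q) = ?s p - ?s q" for p q
          by (simp add: right_diff_distrib left_diff_distrib)
        have sp: "?s (ring_power p j) = ring_power (?s p) j" for p j
          by (induction j) (simp_all add: sm del: mult.assoc)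
        have spc: "?s (power_commutator m a b) = power_commutator m (?s a) (?s b)" for a b
          unfolding power_commutator_def sd sp sm ..
        have sP: "?s w \<in> P" if "w \<in> P" for w
        proof -
          have "?s (t \<bullet> power_commutator m a b) \<in> P" for t a b
            using gen[of t "?s a" "?s b"]
            by (simp add: centroid_mult_left centroid_mult_right flip: spc)
          then have "w \<in> {w. ?s w \<in> P}"
            by (intro ind[OF that]) (use add_subgroupD[OF P] sd in \<open>auto simp: add_subgroup_def\<close>)
          then show ?thesis by simp
        qed
        have "lie (?s z) r \<in> P" for r
        proof -
          have r: "r = ?s (v * r * u)" by (metis e1 mult.assoc uv(1))
          have "lie (?s z) (?s q) = ?s (lie z q)" for q
            unfolding lie_def sd sm ..
          from this[of "v * r * u"] have "lie (?s z) r = ?s (lie z (v * r * u))"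
            unfolding r[symmetric] .
          then show ?thesis using sP z by (simp add: transporter_def)
        qed
        then show ?thesis by (simp add: transporter_def)
      qed
      show ?thesis
      proof (rule commutative_lie_ideal_char2[of ?T z])
        show "p + p = 0" for p :: 'a by (rule two)
        show "lie p q = 0" if "p \<in> ?T" "q \<in> ?T" for p q by (rule comm[OF that])
        show "u * p * v \<in> ?T"
          if "identity_element e" "u * v = e" "v * u = e" "p \<in> ?T" for e u v p
          by (rule conj[OF that])
      qed (fact T z)+
    qed
    then have "central (power_commutator m a b)" for a b :: 'a
      using subsetD[OF subset_transporter[OF PL] gen1[of a b]] by blast
    then show False using power_commutator_not_central[OF inf nc, of m] by blast
  qed
  then obtain u v where "u \<in> ?T" "v \<in> ?T" "lie u v \<noteq> 0" by blast
  then have "commutator_group \<subseteq> P" by (rule commutator_group_subset[OF PL])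
  then show ?thesis by (rule commutator_subset_if_brackets[OF nc _ A PA])
qed

end

section \<open>Products of sequences and inclusion-exclusion\<close>

primrec seq_prod :: "nat \<Rightarrow> (nat \<Rightarrow> 'a::ring) \<Rightarrow> 'a"
  where
    "seq_prod 0 y = y 0"
  | "seq_prod (Suc k) y = seq_prod k y * y (Suc k)"

lemma seq_prod_cong: "(\<And>j. j \<le> k \<Longrightarrow> y j = z j) \<Longrightarrow> seq_prod k y = seq_prod k z"
  by (induction k) simp_all

lemma seq_prod_zero: "i \<le> k \<Longrightarrow> y i = 0 \<Longrightarrow> seq_prod k y = 0"
  by (induction k) (auto simp: le_Suc_eq)

lemma seq_prod_adjacent_zero: "i < k \<Longrightarrow> y i * y (Suc i) = 0 \<Longrightarrow> seq_prod k y = 0"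
proof (induction k)
  case (Suc k)
  show ?case
  proof (cases "i = k")
    case True
    have "seq_prod k y * y (Suc k) = 0"
      using Suc.prems True by (cases k) (simp_all add: mult.assoc)
    then show ?thesis by simp
  next
    case False
    then show ?thesis using Suc by simp
  qed
qed simp

lemma seq_prod_mult:
  "seq_prod a y * seq_prod b z = seq_prod (Suc (a + b)) (\<lambda>j. if j \<le> a then y j else z (j - Suc a))"
proof (induction b)
  case 0
  have "seq_prod a (\<lambda>j. if j \<le> a then y j else z (j - Suc a)) = seq_prod a y"
    by (rule seq_prod_cong) simp
  then show ?case by simp
next
  case (Suc b)
  then show ?case by (simp flip: mult.assoc)
qed

lemma lie_seq_prod:
  "lie (seq_prod k y) r = (\<Sum>i\<le>k. seq_prod k (y(i := lie (y i) r)))"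
proof (induction k)
  case (Suc k)
  have 1: "seq_prod (Suc k) (y(Suc k := z)) = seq_prod k y * z" for z
    unfolding seq_prod.simps by (intro arg_cong2[where f = times] seq_prod_cong) simp_all
  have 2: "(\<Sum>i\<le>k. seq_prod (Suc k) (y(i := lie (y i) r)))
      = (\<Sum>i\<le>k. seq_prod k (y(i := lie (y i) r)) * y (Suc k))"
    by (rule sum.cong) simp_all
  have "lie (seq_prod (Suc k) y) r
      = (\<Sum>i\<le>k. seq_prod k (y(i := lie (y i) r)) * y (Suc k)) + seq_prod k y * lie (y (Suc k)) r"
    unfolding seq_prod.simps lie_mult_left Suc sum_distrib_right by (rule add.commute)
  then show ?case unfolding sum.atMost_Suc 1 2 .
qed simp

lemma seq_prod_sum:
  assumes I: "finite I"
  shows "seq_prod k (\<lambda>j. \<Sum>i\<in>I. Y i j) = (\<Sum>f\<in>PiE {..k} (\<lambda>_. I). seq_prod k (\<lambda>j. Y (f j) j))"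
proof (induction k)
  case 0
  have eq: "PiE {..0 :: nat} (\<lambda>_. I) = (\<lambda>i. (\<lambda>_. undefined)(0 := i)) ` I"
    by (auto simp: PiE_insert_eq)
  have inj: "inj_on (\<lambda>i. (\<lambda>_. undefined)(0 :: nat := i)) I"
    by (rule inj_onI) (metis fun_upd_same)
  show ?case
    unfolding eq sum.reindex[OF inj] by simp
next
  case (Suc k)
  let ?E = "PiE {..k} (\<lambda>_. I)"
  have "inj_on (\<lambda>(y, g). g(Suc k := y)) (I \<times> ?E)"
    by (rule inj_combinator) simp
  then have "(\<Sum>f\<in>PiE {..Suc k} (\<lambda>_. I). seq_prod (Suc k) (\<lambda>j. Y (f j) j))
      = (\<Sum>(i, g)\<in>I \<times> ?E. seq_prod (Suc k) (\<lambda>j. Y ((g(Suc k := i)) j) j))"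
    unfolding atMost_Suc PiE_insert_eq by (subst sum.reindex) (auto simp: case_prod_unfold)
  also have "\<dots> = (\<Sum>(i, g)\<in>I \<times> ?E. seq_prod k (\<lambda>j. Y (g j) j) * Y i (Suc k))"
  proof (rule sum.cong[OF refl], clarify)
    fix i g
    have "seq_prod k (\<lambda>j. Y ((g(Suc k := i)) j) j) = seq_prod k (\<lambda>j. Y (g j) j)"
      by (rule seq_prod_cong) simp
    then show "seq_prod (Suc k) (\<lambda>j. Y ((g(Suc k := i)) j) j) = seq_prod k (\<lambda>j. Y (g j) j) * Y i (Suc k)"
      by simp
  qed
  also have "\<dots> = (\<Sum>g\<in>?E. seq_prod k (\<lambda>j. Y (g j) j)) * (\<Sum>i\<in>I. Y i (Suc k))"
    unfolding sum_product sum.cartesian_product[symmetric] by (rule sum.swap)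
  finally show ?case using Suc by simp
qed

definition subset_sign :: "'i set \<Rightarrow> 'a::ab_group_add \<Rightarrow> 'a"
  where "subset_sign I x = (if even (card I) then x else - x)"

lemma subset_sign_sum: "subset_sign I (\<Sum>f\<in>F. w f) = (\<Sum>f\<in>F. subset_sign I (w f))"
  by (simp add: subset_sign_def sum_negf)

lemma subset_sign_mem: "add_subgroup A \<Longrightarrow> x \<in> A \<Longrightarrow> subset_sign I x \<in> A"
  by (simp add: subset_sign_def add_subgroupD(3))

lemma alternating_sum_zero:
  fixes G :: "'i set \<Rightarrow> 'a::ab_group_add"
  assumes J: "finite J" "j \<in> J" and G: "\<And>I. G (insert j I) = G (I - {j})"
  shows "(\<Sum>I\<in>Pow J. subset_sign I (G I)) = 0"
proof -
  let ?J = "J - {j}"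
  have J': "J = insert j ?J" using J by auto
  have inj: "inj_on (insert j) (Pow ?J)" by (auto simp: inj_on_def)
  have "(\<Sum>I\<in>Pow J. subset_sign I (G I))
      = (\<Sum>I\<in>Pow ?J. subset_sign I (G I)) + (\<Sum>I\<in>insert j ` Pow ?J. subset_sign I (G I))"
    by (subst J', subst Pow_insert, rule sum.union_disjoint) (use J in auto)
  also have "(\<Sum>I\<in>insert j ` Pow ?J. subset_sign I (G I)) = (\<Sum>I\<in>Pow ?J. - subset_sign I (G I))"
    unfolding sum.reindex[OF inj] comp_def
  proof (rule sum.cong[OF refl])
    fix I assume "I \<in> Pow ?J"
    then have "finite I" "j \<notin> I" using J finite_subset[of I J] by auto
    then show "subset_sign (insert j I) (G (insert j I)) = - subset_sign I (G I)"
      by (simp add: subset_sign_def G)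
  qed
  finally show ?thesis by (simp add: sum_negf)
qed

text \<open>A word that misses some j in \<open>J\<close> cancels by pairing I with
  \<open>insert j I\<close>; a word that uses all of \<open>J\<close> is counted only at I =
  J.\<close>

lemma alternating_sum_functions:
  fixes w :: "(nat \<Rightarrow> 'i) \<Rightarrow> 'a::ab_group_add"
  assumes J: "finite J"
  shows "(\<Sum>I\<in>Pow J. subset_sign I (\<Sum>f\<in>PiE {..N} (\<lambda>_. I). w f))
    = subset_sign J (\<Sum>f\<in>{f \<in> PiE {..N} (\<lambda>_. J). f ` {..N} = J}. w f)"
proof -
  let ?E = "PiE {..N} (\<lambda>_. J)"
  have fE: "finite ?E" using J by (simp add: finite_PiE)
  have "(\<Sum>f\<in>PiE {..N} (\<lambda>_. I). w f) = (\<Sum>f\<in>?E. if f ` {..N} \<subseteq> I then w f else 0)"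
    if "I \<in> Pow J" for I
  proof -
    have "PiE {..N} (\<lambda>_. I) = ?E \<inter> {f. f ` {..N} \<subseteq> I}" using that by (auto simp: PiE_def Pi_def)
    then show ?thesis using sum.inter_restrict[OF fE, of w "{f. f ` {..N} \<subseteq> I}"] by simp
  qed
  then have "(\<Sum>I\<in>Pow J. subset_sign I (\<Sum>f\<in>PiE {..N} (\<lambda>_. I). w f))
      = (\<Sum>I\<in>Pow J. \<Sum>f\<in>?E. subset_sign I (if f ` {..N} \<subseteq> I then w f else 0))"
    by (simp add: subset_sign_sum)
  also have "\<dots> = (\<Sum>f\<in>?E. \<Sum>I\<in>Pow J. subset_sign I (if f ` {..N} \<subseteq> I then w f else 0))"
    by (rule sum.swap)
  also have "\<dots> = (\<Sum>f\<in>?E. if f ` {..N} = J then subset_sign J (w f) else 0)"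
  proof (rule sum.cong[OF refl])
    fix f assume f: "f \<in> ?E"
    show "(\<Sum>I\<in>Pow J. subset_sign I (if f ` {..N} \<subseteq> I then w f else 0))
        = (if f ` {..N} = J then subset_sign J (w f) else 0)"
    proof (cases "f ` {..N} = J")
      case True
      have "(\<Sum>I\<in>Pow J. subset_sign I (if f ` {..N} \<subseteq> I then w f else 0))
          = (\<Sum>I\<in>{J}. subset_sign I (if f ` {..N} \<subseteq> I then w f else 0))"
        by (rule sum.mono_neutral_right) (use J True in \<open>auto simp: subset_sign_def\<close>)
      then show ?thesis using True by simp
    next
      case False
      then obtain j where j: "j \<in> J" "j \<notin> f ` {..N}" using f by (auto simp: PiE_def Pi_def)
      then have "(f ` {..N} \<subseteq> insert j I) = (f ` {..N} \<subseteq> I - {j})" for I by auto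
      then show ?thesis using False by (subst alternating_sum_zero[OF J j(1)]) simp_all
    qed
  qed
  also have "\<dots> = (\<Sum>f\<in>{f \<in> ?E. f ` {..N} = J}. subset_sign J (w f))"
    by (subst sum.If_cases[OF fE]) (simp add: Int_def)
  finally show ?thesis by (simp add: subset_sign_sum)
qed

section \<open>Full polarization\<close>

text \<open>\<open>letter 0\<close> spells the word \<open>abab\<dots>\<close> and \<open>letter 1\<close> the word \<open>baba\<dots>\<close>.\<close>

definition letter :: "nat \<Rightarrow> nat \<Rightarrow> 'a \<times> 'a \<Rightarrow> 'a"
  where "letter s j x = (if even (j + s) then fst x else snd x)"

lemma ring_power_Suc_right: "ring_power x (Suc n) = ring_power x n * x"
  using ring_power_commute[of x x n] by simp

lemma ring_power_seq_prod:
  "ring_power (a * b) k = seq_prod (2 * k + 1) (\<lambda>j. letter 0 j (a, b))"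
  "ring_power (b * a) k = seq_prod (2 * k + 1) (\<lambda>j. letter 1 j (a, b))"
proof -
  have "ring_power (letter s 0 (a, b) * letter s 1 (a, b)) k = seq_prod (2 * k + 1) (\<lambda>j. letter s j (a, b))" for s
  proof (induction k)
    case (Suc k)
    have "2 * Suc k + 1 = Suc (Suc (2 * k + 1))" by simp
    moreover have "letter s (Suc (2 * k + 1)) (a, b) = letter s 0 (a, b)"
      "letter s (Suc (Suc (2 * k + 1))) (a, b) = letter s 1 (a, b)"
      by (simp_all add: letter_def)
    ultimately show ?case
      unfolding ring_power_Suc_right Suc by (simp only: seq_prod.simps mult.assoc)
  qed simp
  from this[of 0] this[of 1] show
    "ring_power (a * b) k = seq_prod (2 * k + 1) (\<lambda>j. letter 0 j (a, b))"
    "ring_power (b * a) k = seq_prod (2 * k + 1) (\<lambda>j. letter 1 j (a, b))"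
    by (simp_all add: letter_def)
qed

text \<open>Surjections of a finite set onto itself, hence permutations; \<open>PiE\<close> fixes
  the values outside, so that each counts once in a sum.\<close>

definition surj_words :: "nat \<Rightarrow> (nat \<Rightarrow> nat) set"
  where "surj_words N = {f \<in> PiE {..N} (\<lambda>_. {..N}). f ` {..N} = {..N}}"

lemma surj_words_inj: "f ` {..N :: nat} = {..N} \<Longrightarrow> inj_on f {..N}"
  by (rule eq_card_imp_inj_on) simp_all

text \<open>The multilinear form of (ab)^n - (ba)^n for N + 1 = 2n: each pair occupies one position,
  whose parity decides which component is read.\<close>

definition polarized :: "nat \<Rightarrow> (nat \<Rightarrow> 'a::ring \<times> 'a) \<Rightarrow> 'a"
  where "polarized N X = (\<Sum>f\<in>surj_words N. seq_prod N (\<lambda>j. letter 0 j (X (f j))))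
    - (\<Sum>f\<in>surj_words N. seq_prod N (\<lambda>j. letter 1 j (X (f j))))"

text \<open>Alternating over the partial sums of 2m + 2 pairs leaves the words that use every pair.
  Words of lower powers are too short for this, so the leading part is isolated without any
  division.\<close>

lemma polarized_mem:
  fixes A :: "'a::ring set" and c :: "nat \<Rightarrow> 'a centroid"
  assumes A: "add_subgroup A" and mem: "\<And>a b. (\<Sum>k<Suc m. c k \<bullet> power_commutator k a b) \<in> A"
  shows "c m \<bullet> polarized (2 * m + 1) X \<in> A"
proof -
  let ?J = "{..2 * m + 1 :: nat}"
  let ?a = "\<lambda>I. \<Sum>i\<in>I. fst (X i)" and ?b = "\<lambda>I. \<Sum>i\<in>I. snd (X i)"
  let ?w = "\<lambda>s k f. seq_prod (2 * k + 1) (\<lambda>j. letter s j (X (f j)))"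
  let ?B = "\<lambda>k. {f \<in> PiE {..2 * k + 1} (\<lambda>_. ?J). f ` {..2 * k + 1} = ?J}"
  have letter_sum: "letter s j (?a I, ?b I) = (\<Sum>i\<in>I. letter s j (X i))" for s j I
    by (simp add: letter_def)
  have pc: "power_commutator k (?a I) (?b I)
      = (\<Sum>f\<in>PiE {..2 * k + 1} (\<lambda>_. I). ?w 0 k f - ?w 1 k f)" if "finite I" for k I
    unfolding power_commutator_def ring_power_seq_prod(1)[of "?a I" "?b I"]
      ring_power_seq_prod(2)[of "?b I" "?a I"] letter_sum seq_prod_sum[OF that] sum_subtractf ..
  have full: "(\<Sum>I\<in>Pow ?J. subset_sign I (power_commutator k (?a I) (?b I)))
      = (\<Sum>f\<in>?B k. ?w 0 k f - ?w 1 k f)" for k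
  proof -
    have "(\<Sum>I\<in>Pow ?J. subset_sign I (power_commutator k (?a I) (?b I)))
        = (\<Sum>I\<in>Pow ?J. subset_sign I (\<Sum>f\<in>PiE {..2 * k + 1} (\<lambda>_. I). ?w 0 k f - ?w 1 k f))"
    proof (rule sum.cong[OF refl])
      fix I assume "I \<in> Pow ?J"
      then have "finite I" using finite_subset by blast
      then show "subset_sign I (power_commutator k (?a I) (?b I))
          = subset_sign I (\<Sum>f\<in>PiE {..2 * k + 1} (\<lambda>_. I). ?w 0 k f - ?w 1 k f)"
        by (simp only: pc)
    qed
    also have "\<dots> = subset_sign ?J (\<Sum>f\<in>?B k. ?w 0 k f - ?w 1 k f)"
      by (rule alternating_sum_functions) simp
    \<comment> \<open>The number 2m + 2 of indices is even, so the global sign is +.\<close>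
    finally show ?thesis by (simp add: subset_sign_def)
  qed
  have "(\<Sum>I\<in>Pow ?J. subset_sign I (\<Sum>k<Suc m. c k \<bullet> power_commutator k (?a I) (?b I))) \<in> A"
    by (intro add_subgroup_sum[OF A] subset_sign_mem[OF A] mem)
  also have "(\<Sum>I\<in>Pow ?J. subset_sign I (\<Sum>k<Suc m. c k \<bullet> power_commutator k (?a I) (?b I)))
      = (\<Sum>I\<in>Pow ?J. \<Sum>k<Suc m. c k \<bullet> subset_sign I (power_commutator k (?a I) (?b I)))"
    by (rule sum.cong[OF refl]) (simp add: subset_sign_def sum_negf centroid_minus_right)
  also have "\<dots> = (\<Sum>k<Suc m. c k \<bullet> (\<Sum>I\<in>Pow ?J. subset_sign I (power_commutator k (?a I) (?b I))))"
    unfolding centroid_sum_right by (rule sum.swap)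
  also have "\<dots> = (\<Sum>k<Suc m. c k \<bullet> (\<Sum>f\<in>?B k. ?w 0 k f - ?w 1 k f))"
    unfolding full ..
  also have "\<dots> = (\<Sum>k<Suc m. if k = m then c m \<bullet> polarized (2 * m + 1) X else 0)"
  proof (rule sum.cong[OF refl])
    fix k assume k: "k \<in> {..<Suc m}"
    show "c k \<bullet> (\<Sum>f\<in>?B k. ?w 0 k f - ?w 1 k f) = (if k = m then c m \<bullet> polarized (2 * m + 1) X else 0)"
    proof (cases "k = m")
      case True
      then show ?thesis by (simp add: polarized_def surj_words_def sum_subtractf)
    next
      case False
      have "f ` {..2 * k + 1} \<noteq> ?J" for f :: "nat \<Rightarrow> nat"
        using card_image_le[of "{..2 * k + 1}" f] k False by auto
      then have "?B k = {}" by blast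
      then show ?thesis using False by (simp only: sum.empty centroid_zero_right if_False)
    qed
  qed
  finally show ?thesis by simp
qed

text \<open>Inner derivations act on one argument at a time, so the values of
  \<open>polarized\<close> span a Lie ideal. Position \<open>l\<close> of a word holds argument
  \<open>f l\<close>.\<close>

lemma lie_polarized:
  "lie (polarized N X) r = (\<Sum>i\<le>N. polarized N (X(i := (lie (fst (X i)) r, lie (snd (X i)) r))))"
proof -
  let ?X = "\<lambda>i. X(i := (lie (fst (X i)) r, lie (snd (X i)) r))"
  have bracket: "lie (seq_prod N (\<lambda>j. letter s j (X (f j)))) r
      = (\<Sum>i\<le>N. seq_prod N (\<lambda>j. letter s j (?X i (f j))))" if "f \<in> surj_words N" for s f
  proof -
    have f: "f ` {..N} = {..N}" using that by (simp add: surj_words_def)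
    note inj = surj_words_inj[OF f]
    have "lie (seq_prod N (\<lambda>j. letter s j (X (f j)))) r
        = (\<Sum>l\<le>N. seq_prod N ((\<lambda>j. letter s j (X (f j)))(l := lie (letter s l (X (f l))) r)))"
      by (rule lie_seq_prod)
    also have "\<dots> = (\<Sum>l\<le>N. seq_prod N (\<lambda>j. letter s j (?X (f l) (f j))))"
    proof (intro sum.cong refl seq_prod_cong)
      fix l j assume "l \<in> {..N}" "j \<le> N"
      then show "((\<lambda>j. letter s j (X (f j)))(l := lie (letter s l (X (f l))) r)) j
          = letter s j (?X (f l) (f j))"
        using inj_onD[OF inj, of j l] by (auto simp: letter_def)
    qed
    also have "\<dots> = (\<Sum>i\<in>f ` {..N}. seq_prod N (\<lambda>j. letter s j (?X i (f j))))"
      unfolding sum.reindex[OF inj] by simp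
    finally show ?thesis unfolding f .
  qed
  have "(\<Sum>f\<in>surj_words N. lie (seq_prod N (\<lambda>j. letter s j (X (f j)))) r)
      = (\<Sum>i\<le>N. \<Sum>f\<in>surj_words N. seq_prod N (\<lambda>j. letter s j (?X i (f j))))" for s
    by (subst sum.swap) (intro sum.cong refl bracket)
  then show ?thesis
    by (simp add: polarized_def lie_simps lie_sum_left sum_subtractf)
qed

definition reordered :: "nat \<Rightarrow> (nat \<Rightarrow> 'a::ring) \<Rightarrow> 'a set"
  where "reordered N x = {seq_prod N (\<lambda>j. x (h j)) | h. h ` {..N} = {..N} \<and> (\<exists>j\<le>N. h j \<noteq> j)}"

text \<open>In the first sum of \<open>polarized\<close>, \<open>x i\<close> survives only at
  positions of its own parity, in the second only at the others; so the natural order occurs exactly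
  once.\<close>

definition alternating_pairs :: "(nat \<Rightarrow> 'a::ring) \<Rightarrow> nat \<Rightarrow> 'a \<times> 'a"
  where "alternating_pairs x i = (if even i then (x i, 0) else (0, x i))"

lemma polarized_alternating:
  "polarized N (alternating_pairs x) - seq_prod N x \<in> group_closure (reordered N x)"
proof -
  let ?G = "group_closure (reordered N x)"
  have G: "add_subgroup ?G" by simp
  let ?id = "restrict (\<lambda>j. j) {..N}"
  let ?X = "alternating_pairs x"
  let ?w = "\<lambda>s f. seq_prod N (\<lambda>j. letter s j (?X (f j)))"
  have fin: "finite (surj_words N)"
    unfolding surj_words_def by (rule finite_subset[of _ "PiE {..N} (\<lambda>_. {..N})"]) (blast, simp add: finite_PiE)
  have id: "?id \<in> surj_words N" by (auto simp: surj_words_def)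
  have val: "letter s j (?X i) = (if even i = even (j + s) then x i else 0)" for s i j
    by (simp add: letter_def alternating_pairs_def)
  have w: "?w s f = seq_prod N (\<lambda>j. x (f j)) \<or> ?w s f = 0" for s f
  proof (cases "\<forall>j\<le>N. even (f j) = even (j + s)")
    case True
    then have "?w s f = seq_prod N (\<lambda>j. x (f j))"
      by (intro seq_prod_cong) (simp add: val)
    then show ?thesis ..
  next
    case False
    then obtain j where j: "j \<le> N" "even (f j) \<noteq> even (j + s)" by blast
    have "letter s j (?X (f j)) = 0" unfolding val if_not_P[OF j(2)] ..
    then have "?w s f = 0" by (rule seq_prod_zero[OF j(1)])
    then show ?thesis ..
  qed
  have mem: "?w s f \<in> ?G" if f: "f \<in> surj_words N - {?id}" for s f
  proof -
    have "\<exists>j\<le>N. f j \<noteq> j"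
    proof (rule ccontr)
      assume "\<not> ?thesis"
      then have "f = ?id" using f by (intro ext) (auto simp: surj_words_def PiE_def extensional_def)
      then show False using f by blast
    qed
    then have "seq_prod N (\<lambda>j. x (f j)) \<in> ?G"
      using f by (intro group_closure.base) (auto simp: reordered_def surj_words_def)
    then show ?thesis using w[of s f] add_subgroupD(1)[OF G] by auto
  qed
  have id0: "?w 0 ?id = seq_prod N x" by (rule seq_prod_cong) (simp add: val)
  have id1: "?w 1 ?id = 0" by (rule seq_prod_zero[of 0]) (simp_all add: val)
  have "polarized N ?X - seq_prod N x
      = (\<Sum>f\<in>surj_words N - {?id}. ?w 0 f) - (\<Sum>f\<in>surj_words N - {?id}. ?w 1 f)"
    unfolding polarized_def sum.remove[OF fin id] id0 id1 by simp
  also have "\<dots> \<in> ?G"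
    by (intro add_subgroupD(2)[OF G] add_subgroup_sum[OF G] mem)
  finally show ?thesis .
qed

lemma group_closure_mult:
  fixes Y Z :: "'a::ring set"
  assumes G: "add_subgroup G" and YZ: "\<And>y z. y \<in> Y \<Longrightarrow> z \<in> Z \<Longrightarrow> y * z \<in> G"
    and y: "y \<in> group_closure Y" and z: "z \<in> group_closure Z"
  shows "y * z \<in> G"
proof -
  note d = add_subgroupD[OF G]
  have 1: "y * z \<in> G" if "y \<in> Y" for y
    using group_closure_induct_subset[OF z, of "{z. y * z \<in> G}"] YZ[OF that] d
    by (auto simp: add_subgroup_def right_diff_distrib)
  show ?thesis
    using group_closure_induct_subset[OF y, of "{y. y * z \<in> G}"] 1 d
    by (auto simp: add_subgroup_def left_diff_distrib)
qed

context simple_rng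
begin

text \<open>For two blocks of N + 1 elements the values are u = w + u' and v = w' + v' with
  reordered u', v'. In uv only w w' has the natural order, and in vu no term has it, as each starts
  in the second block. So [u, v] = 0 would put the full product into the group.\<close>

lemma polarized_noncommuting:
  fixes x :: "nat \<Rightarrow> 'a"
  assumes N: "odd N" and gen: "seq_prod (Suc (N + N)) x \<notin> group_closure (reordered (Suc (N + N)) x)"
  obtains X Y :: "nat \<Rightarrow> 'a \<times> 'a" where "lie (polarized N X) (polarized N Y) \<noteq> 0"
proof -
  let ?M = "Suc (N + N)"
  let ?G = "group_closure (reordered ?M x)"
  define x' where "x' = (\<lambda>i. x (i + Suc N))"
  let ?X = "alternating_pairs x" and ?Y = "alternating_pairs x'"
  let ?u = "polarized N ?X" and ?v = "polarized N ?Y"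
  have G: "add_subgroup ?G" by simp
  note d = add_subgroupD[OF G]
  have perm: "(\<lambda>j. if j \<le> N then f j else g (j - Suc N)) ` {..?M} = {..?M}"
    if fg: "f ` {..N} \<union> (\<lambda>j. g j) ` {..N} = {..?M}" for f g :: "nat \<Rightarrow> nat"
  proof -
    have split: "{..?M} = {..N} \<union> (\<lambda>j. j + Suc N) ` {..N}"
    proof (intro equalityI subsetI)
      fix j assume j: "j \<in> {..?M}"
      show "j \<in> {..N} \<union> (\<lambda>j. j + Suc N) ` {..N}"
      proof (cases "j \<le> N")
        case False
        then have "j = (j - Suc N) + Suc N" "j - Suc N \<in> {..N}" using j by auto
        then show ?thesis by blast
      qed simp
    qed auto
    show ?thesis
      by (subst split, simp only: image_Un image_image) (use fg in simp)
  qed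
  have shift: "(\<lambda>j. g j + Suc N) ` {..N} = {Suc N..?M}" if "g ` {..N} = {..N}" for g :: "nat \<Rightarrow> nat"
  proof -
    have "(\<lambda>j. g j + Suc N) ` {..N} = (\<lambda>j. j + Suc N) ` (g ` {..N})" by (simp add: image_image)
    also have "\<dots> = {Suc N..?M}" unfolding that
      by (simp only: atMost_atLeast0 image_add_atLeastAtMost') simp
    finally show ?thesis .
  qed
  have Un: "{..N} \<union> {Suc N..?M} = {..?M}" by auto
  have fg: "seq_prod N (\<lambda>j. x (f j)) * seq_prod N (\<lambda>j. x' (g j)) \<in> ?G"
    if f: "f ` {..N} = {..N}" and g: "g ` {..N} = {..N}"
      and ne: "(\<exists>j\<le>N. f j \<noteq> j) \<or> (\<exists>j\<le>N. g j \<noteq> j)" for f g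
  proof -
    let ?h = "\<lambda>j. if j \<le> N then f j else g (j - Suc N) + Suc N"
    have "?h ` {..?M} = {..?M}"
      using perm[of f "\<lambda>j. g j + Suc N"] unfolding f shift[OF g] Un by simp
    moreover have "\<exists>j\<le>?M. ?h j \<noteq> j"
      using ne
    proof (elim disjE exE conjE)
      fix j assume "j \<le> N" "f j \<noteq> j"
      then show ?thesis by (intro exI[of _ j]) simp
    next
      fix j assume "j \<le> N" "g j \<noteq> j"
      then show ?thesis by (intro exI[of _ "j + Suc N"]) simp
    qed
    moreover have "seq_prod N (\<lambda>j. x (f j)) * seq_prod N (\<lambda>j. x' (g j)) = seq_prod ?M (\<lambda>j. x (?h j))"
      unfolding seq_prod_mult by (rule seq_prod_cong) (simp add: x'_def)
    ultimately show ?thesis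
      by (intro group_closure.base) (auto simp only: reordered_def)
  qed
  have gf: "seq_prod N (\<lambda>j. x' (g j)) * seq_prod N (\<lambda>j. x (f j)) \<in> ?G"
    if f: "f ` {..N} = {..N}" and g: "g ` {..N} = {..N}" for f g
  proof -
    let ?h = "\<lambda>j. if j \<le> N then g j + Suc N else f (j - Suc N)"
    have "?h ` {..?M} = {..?M}"
      using perm[of "\<lambda>j. g j + Suc N" f] unfolding f shift[OF g] using Un by (simp add: Un_commute)
    moreover have "\<exists>j\<le>?M. ?h j \<noteq> j" by (rule exI[of _ 0]) simp
    moreover have "seq_prod N (\<lambda>j. x' (g j)) * seq_prod N (\<lambda>j. x (f j)) = seq_prod ?M (\<lambda>j. x (?h j))"
      unfolding seq_prod_mult by (rule seq_prod_cong) (simp add: x'_def)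
    ultimately show ?thesis
      by (intro group_closure.base) (auto simp only: reordered_def)
  qed
  define w w' where "w = seq_prod N x" and "w' = seq_prod N x'"
  obtain u' v' where u': "?u = w + u'" "u' \<in> group_closure (reordered N x)"
    and v': "?v = w' + v'" "v' \<in> group_closure (reordered N x')"
    using polarized_alternating[of N x] polarized_alternating[of N x'] unfolding w_def w'_def
    by (metis add.commute diff_add_cancel)
  have R: thesis if "z \<in> reordered N y"
    "\<And>h. z = seq_prod N (\<lambda>j. y (h j)) \<Longrightarrow> h ` {..N} = {..N} \<Longrightarrow> \<exists>j\<le>N. h j \<noteq> j \<Longrightarrow> thesis"
    for z thesis and y :: "nat \<Rightarrow> 'a"
    using that by (auto simp: reordered_def)
  have id: "(\<lambda>j. j) ` {..N} = {..N}" by simp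
  have wc: "w \<in> group_closure {w}" "w' \<in> group_closure {w'}" by (auto intro: group_closure.base)
  have 1: "w * v' \<in> ?G"
  proof (rule group_closure_mult[OF G _ wc(1) v'(2)])
    fix y z assume y: "y \<in> {w}" and z: "z \<in> reordered N x'"
    from z show "y * z \<in> ?G"
      by (rule R) (use y fg[OF id] in \<open>simp add: w_def\<close>)
  qed
  have 2: "u' * w' \<in> ?G"
  proof (rule group_closure_mult[OF G _ u'(2) wc(2)])
    fix y z assume y: "y \<in> reordered N x" and z: "z \<in> {w'}"
    from y show "y * z \<in> ?G"
      by (rule R) (use z fg[OF _ id] in \<open>simp add: w'_def\<close>)
  qed
  have 3: "u' * v' \<in> ?G"
  proof (rule group_closure_mult[OF G _ u'(2) v'(2)])
    fix y z assume y: "y \<in> reordered N x" and z: "z \<in> reordered N x'"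
    show "y * z \<in> ?G"
      by (rule R[OF y], rule R[OF z]) (simp add: fg)
  qed
  have 4: "w' * w \<in> ?G" using gf[OF id id] by (simp add: w_def w'_def)
  have 5: "w' * u' \<in> ?G"
  proof (rule group_closure_mult[OF G _ wc(2) u'(2)])
    fix y z assume y: "y \<in> {w'}" and z: "z \<in> reordered N x"
    from z show "y * z \<in> ?G"
      by (rule R) (use y gf[OF _ id] in \<open>simp add: w'_def\<close>)
  qed
  have 6: "v' * w \<in> ?G"
  proof (rule group_closure_mult[OF G _ v'(2) wc(1)])
    fix y z assume y: "y \<in> reordered N x'" and z: "z \<in> {w}"
    from y show "y * z \<in> ?G"
      by (rule R) (use z gf[OF id] in \<open>simp add: w_def\<close>)
  qed
  have 7: "v' * u' \<in> ?G"
  proof (rule group_closure_mult[OF G _ v'(2) u'(2)])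
    fix y z assume y: "y \<in> reordered N x'" and z: "z \<in> reordered N x"
    show "y * z \<in> ?G"
      by (rule R[OF y], rule R[OF z]) (simp add: gf)
  qed
  have ww: "w * w' = seq_prod ?M x"
    unfolding w_def w'_def seq_prod_mult by (rule seq_prod_cong) (simp add: x'_def)
  have "lie ?u ?v \<noteq> 0"
  proof
    assume "lie ?u ?v = 0"
    then have "seq_prod ?M x = (w' * w + w' * u') + (v' * w + v' * u') - (w * v' + u' * w' + u' * v')"
      unfolding lie_def u'(1) v'(1) ww[symmetric] by (simp add: algebra_simps)
    also have "\<dots> \<in> ?G"
      by (intro d(2) d(4) 1 2 3 4 5 6 7)
    finally show False using gen by blast
  qed
  then show thesis by (rule that)
qed

text \<open>Two polarizations with last index N = 2m + 1 need elements up to 2N + 1 = 4m + 3. Here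
  the Lie ideal itself lies in \<open>A\<close>, not only its brackets.\<close>

lemma commutator_group_subset_if_sequence:
  fixes A :: "'a set" and c :: "nat \<Rightarrow> 'a centroid" and x :: "nat \<Rightarrow> 'a"
  assumes gen: "seq_prod (4 * m + 3) x \<notin> group_closure (reordered (4 * m + 3) x)"
    and A: "add_subgroup A"
    and mem: "\<And>a b. (\<Sum>k<Suc m. c k \<bullet> power_commutator k a b) \<in> A" and cm: "c m \<noteq> 0"
  shows "commutator_group \<subseteq> A"
proof -
  let ?N = "2 * m + 1"
  let ?S = "{c m \<bullet> polarized ?N X | X. True}"
  let ?P = "group_closure ?S"
  have P: "lie_ideal ?P"
    unfolding lie_ideal_def
  proof (intro conjI ballI allI)
    fix z r assume z: "z \<in> ?P"
    have d: "add_subgroup {z. lie z r \<in> ?P}"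
      using add_subgroupD[OF add_subgroup_group_closure[of ?S]]
      by (simp add: add_subgroup_def lie_simps)
    have "lie (c m \<bullet> polarized ?N X) r \<in> ?P" for X
      unfolding centroid_lie lie_polarized centroid_sum_right
      by (intro add_subgroup_sum group_closure.base) auto
    then have "z \<in> {z. lie z r \<in> ?P}"
      by (intro group_closure_induct_subset[OF z d]) blast
    then show "lie z r \<in> ?P" by simp
  qed simp
  have N: "4 * m + 3 = Suc (?N + ?N)" by simp
  have oN: "odd ?N" by simp
  obtain X Y :: "nat \<Rightarrow> 'a \<times> 'a" where XY: "lie (polarized ?N X) (polarized ?N Y) \<noteq> 0"
    using polarized_noncommuting[OF oN gen[unfolded N]] .
  have "c m \<bullet> polarized ?N Z \<in> transporter ?P" for Z
    by (intro subsetD[OF subset_transporter[OF P]] group_closure.base) blast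
  moreover have "lie (c m \<bullet> polarized ?N X) (c m \<bullet> polarized ?N Y) \<noteq> 0"
    unfolding centroid_lie using centroid_app_eq_0 cm XY by blast
  ultimately have "commutator_group \<subseteq> ?P" using commutator_group_subset[OF P] by blast
  also have "\<dots> \<subseteq> A"
    by (rule group_closure_least[OF A]) (use polarized_mem[OF A mem] in blast)
  finally show ?thesis .
qed

section \<open>Orthogonal idempotents\<close>

text \<open>The x with finite x R b form an additive group that contains every u a v, as u a v R b
  is inside u (a R b); likewise on the right.\<close>

lemma sandwich_finite_everywhere:
  fixes a b x y :: 'a
  assumes ab: "a \<noteq> 0" "b \<noteq> 0" and fin: "finite (range (\<lambda>r. a * r * b))"
  shows "finite (range (\<lambda>r. x * r * y))"
proof -
  have sub: "finite (range (\<lambda>r. f r - g r))" if "finite (range f)" "finite (range g)" for f g :: "'a \<Rightarrow> 'a"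
    by (rule finite_subset[of _ "(\<lambda>(u, v). u - v) ` (range f \<times> range g)"]) (use that in auto)
  have "x \<in> {x. finite (range (\<lambda>r. x * r * b))}" for x
  proof (rule generated[OF ab(1)])
    show "add_subgroup {x. finite (range (\<lambda>r. x * r * b))}"
      by (simp add: add_subgroup_def left_diff_distrib sub)
    fix u v
    have "range (\<lambda>r. u * a * v * r * b) \<subseteq> (\<lambda>z. u * z) ` range (\<lambda>r. a * r * b)"
    proof clarify
      fix r
      have "u * a * v * r * b = u * (a * (v * r) * b)" by (simp add: mult.assoc)
      then show "u * a * v * r * b \<in> (\<lambda>z. u * z) ` range (\<lambda>r. a * r * b)" by blast
    qed
    then show "u * a * v \<in> {x. finite (range (\<lambda>r. x * r * b))}"
      using fin finite_subset by blast
  qed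
  then have 1: "finite (range (\<lambda>r. x * r * b))" for x by simp
  have "y \<in> {y. finite (range (\<lambda>r. x * r * y))}"
  proof (rule generated[OF ab(2)])
    show "add_subgroup {y. finite (range (\<lambda>r. x * r * y))}"
      by (simp add: add_subgroup_def right_diff_distrib sub)
    fix u v
    have "range (\<lambda>r. x * r * (u * b * v)) \<subseteq> (\<lambda>z. z * v) ` range (\<lambda>r. x * r * b)"
    proof clarify
      fix r
      have "x * r * (u * b * v) = x * (r * u) * b * v" by (simp add: mult.assoc)
      then show "x * r * (u * b * v) \<in> (\<lambda>z. z * v) ` range (\<lambda>r. x * r * b)" by blast
    qed
    then show "u * b * v \<in> {y. finite (range (\<lambda>r. x * r * y))}"
      using 1[of x] finite_subset by blast
  qed
  then show ?thesis by simp
qed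

lemma idempotent_power:
  fixes t :: 'a
  assumes fin: "finite (range (\<lambda>r. t * r * t))"
  obtains k where "ring_power t k * ring_power t k = ring_power t k"
proof -
  have "range (\<lambda>k. ring_power t (k + 2)) \<subseteq> range (\<lambda>r. t * r * t)"
  proof clarify
    fix k
    have "ring_power t (k + 2) = t * ring_power t k * t"
      by (simp add: mult.assoc ring_power_commute[of t t k, OF refl, symmetric])
    then show "ring_power t (k + 2) \<in> range (\<lambda>r. t * r * t)" by blast
  qed
  then have "finite (range (\<lambda>k. ring_power t (k + 2)))" using fin finite_subset by blast
  then have "\<not> inj (\<lambda>k. ring_power t (k + 2))" using finite_imageD infinite_UNIV_nat by blast
  then obtain i j where ij: "ring_power t (i + 2) = ring_power t (j + 2)" "i < j"
    unfolding inj_def by (metis linorder_neqE_nat)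
  define p where "p = j - i"
  have p: "p > 0" "j = i + p" using ij(2) by (simp_all add: p_def)
  have add: "ring_power t (i + 2 + n) = ring_power t (i + 2 + n + p)" for n
  proof (induction n)
    case 0
    then show ?case using ij(1) p(2) by (simp add: algebra_simps)
  next
    case (Suc n)
    then show ?case by simp
  qed
  have "ring_power t (i + 2 + n) = ring_power t (i + 2 + n + p * q)" for n q
  proof (induction q)
    case (Suc q)
    then show ?case using add[of "n + p * q"] by (simp add: algebra_simps)
  qed simp
  \<comment> \<open>The exponent p (i + 3) is a multiple of the period \<open>p\<close> and at least
    i + 3, where periodicity starts, so doubling it changes nothing. Indices of
    \<open>ring_power\<close> are one less.\<close>
  from this[of "p * (i + 3) - (i + 3)" "i + 3"]
  have "ring_power t (p * (i + 3) - 1) = ring_power t (p * (i + 3) - 1 + p * (i + 3))"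
    using p(1) by (cases p) (simp_all add: algebra_simps)
  also have "p * (i + 3) - 1 + p * (i + 3) = Suc ((p * (i + 3) - 1) + (p * (i + 3) - 1))"
    using p(1) by (cases p) simp_all
  finally show thesis
    by (intro that[of "p * (i + 3) - 1"]) (rule trans[OF ring_power_mult sym])
qed

text \<open>If \<open>|aRb|\<close> is minimal among nonzero \<open>a, b\<close> in the corner, then every nonzero \<open>y \<in> aRb\<close> satisfies
  \<open>aRb = yRb\<close>; hence \<open>y = y z b\<close> and a power of \<open>z b\<close> is a nonzero idempotent.\<close>

lemma idempotent_complement:
  fixes e :: 'a
  assumes inf: "infinite (UNIV :: 'a set)" and fin: "\<And>x y :: 'a. finite (range (\<lambda>r. x * r * y))"
    and e: "e * e = e"
  obtains f where "f \<noteq> 0" "f * f = f" "e * f = 0" "f * e = 0"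
proof -
  let ?S = "{s. e * s = 0 \<and> s * e = 0}"
  have ee: "e * (e * z) = e * z" "z * e * e = z * e" for z
    using e by (simp_all add: mult.assoc flip: mult.assoc[of e e z])
  have "\<exists>s\<in>?S. s \<noteq> 0"
  proof (rule ccontr)
    assume "\<not> ?thesis"
    then have S0: "s = 0" if "e * s = 0" "s * e = 0" for s using that by blast
    have l: "e * (x - e * x) = 0" and r: "(x - x * e) * e = 0" for x
      by (simp_all add: right_diff_distrib left_diff_distrib ee)
    \<comment> \<open>These elements lie in \<open>?S\<close>. Their vanishing makes
      \<open>e\<close> a one-sided, then a two-sided identity, and R = eRe would be finite.\<close>
    have "(x - e * x) * q * (y - y * e) = 0" for x y q
    proof (rule S0)
      show "e * ((x - e * x) * q * (y - y * e)) = 0"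
        using l[of x] by (simp only: mult.assoc[symmetric] mult_zero_left)
      show "(x - e * x) * q * (y - y * e) * e = 0"
        using r[of y] by (simp only: mult.assoc mult_zero_right)
    qed
    then have "(\<forall>x. x - e * x = 0) \<or> (\<forall>y. y - y * e = 0)" using prime by blast
    then have "(\<forall>x. x = e * x) \<and> (\<forall>y. y = y * e)"
    proof
      assume l: "\<forall>x. x - e * x = 0"
      have "y - y * e = 0" for y
      proof (rule right_annihilator)
        fix x
        have "x = e * x" using l by (metis eq_iff_diff_eq_0)
        then have "(y - y * e) * x = (y - y * e) * (e * x)" by simp
        also have "\<dots> = (y * e - y * e * e) * x" by (simp only: left_diff_distrib mult.assoc)
        finally show "(y - y * e) * x = 0" by (simp add: ee)
      qed
      then show ?thesis using l by (metis eq_iff_diff_eq_0)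
    next
      assume r: "\<forall>y. y - y * e = 0"
      have "x - e * x = 0" for x
      proof (rule left_annihilator)
        fix y
        have "y = y * e" using r by (metis eq_iff_diff_eq_0)
        then have "y * (x - e * x) = y * e * (x - e * x)" by simp
        also have "\<dots> = y * (e * x - e * (e * x))" by (simp only: right_diff_distrib mult.assoc)
        finally show "y * (x - e * x) = 0" by (simp add: ee)
      qed
      then show ?thesis using r by (metis eq_iff_diff_eq_0)
    qed
    then have "x = e * x * e" for x by metis
    then have "(UNIV :: 'a set) \<subseteq> range (\<lambda>r. e * r * e)" by blast
    then show False using inf fin[of e e] finite_subset by blast
  qed
  then obtain s0 where s0: "s0 \<in> ?S" "s0 \<noteq> 0" by blast
  let ?card = "\<lambda>(a, b). card (range (\<lambda>r. a * r * b))"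
  let ?Q = "\<lambda>(a, b). a \<in> ?S \<and> a \<noteq> 0 \<and> b \<in> ?S \<and> b \<noteq> 0"
  have "?Q (s0, s0)" using s0 by simp
  then obtain ab where ab: "?Q ab" and min: "\<And>q. ?Q q \<Longrightarrow> ?card ab \<le> ?card q"
    using ex_has_least_nat[of ?Q _ ?card] by blast
  obtain a b where "ab = (a, b)" by (cases ab)
  then have a: "a \<in> ?S" "a \<noteq> 0" and b: "b \<in> ?S" "b \<noteq> 0"
    and min: "\<And>c. c \<in> ?S \<Longrightarrow> c \<noteq> 0 \<Longrightarrow> card (range (\<lambda>r. a * r * b)) \<le> card (range (\<lambda>r. c * r * b))"
    using ab min[of "(_, b)"] by auto
  obtain s where s: "a * s * b \<noteq> 0" using prime a(2) b(2) by blast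
  define y where "y = a * s * b"
  have y: "y \<noteq> 0" "e * y = 0" "y * e = 0"
    using s a b by (simp_all add: y_def mult.assoc) (simp flip: mult.assoc)
  have "range (\<lambda>r. y * r * b) = range (\<lambda>r. a * r * b)"
  proof (rule card_seteq[OF fin])
    show "range (\<lambda>r. y * r * b) \<subseteq> range (\<lambda>r. a * r * b)"
    proof clarify
      fix r show "y * r * b \<in> range (\<lambda>r. a * r * b)"
        by (rule range_eqI[of _ _ "s * b * r"]) (simp add: y_def mult.assoc)
    qed
    show "card (range (\<lambda>r. a * r * b)) \<le> card (range (\<lambda>r. y * r * b))"
      by (rule min) (use y in simp_all)
  qed
  then obtain z where z: "y = y * z * b" unfolding y_def by blast
  \<comment> \<open>Subtracting \<open>e * z\<close> moves \<open>t\<close> into the corner and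
    keeps y t = y because y e = 0; thus no power of \<open>t\<close> vanishes.\<close>
  define t where "t = (z - e * z) * b"
  have yt: "y * t = y"
    using z y(3) by (simp add: t_def left_diff_distrib right_diff_distrib flip: mult.assoc)
  have te: "e * t = 0" "t * e = 0"
    using b(1) by (simp_all add: t_def left_diff_distrib right_diff_distrib ee mult.assoc)
  have "y * ring_power t k = y" for k
    by (induction k) (simp_all add: yt flip: mult.assoc)
  then have nz: "ring_power t k \<noteq> 0" for k using y(1) by (metis mult_zero_right)
  have pe: "e * ring_power t k = 0" "ring_power t k * e = 0" for k
    by (induction k) (simp_all add: te mult.assoc, simp_all add: te flip: mult.assoc)
  obtain k where "ring_power t k * ring_power t k = ring_power t k"
    using idempotent_power[OF fin] .
  then show thesis using that nz pe by blast
qed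

lemma orthogonal_idempotents:
  assumes inf: "infinite (UNIV :: 'a set)" and fin: "\<And>x y :: 'a. finite (range (\<lambda>r. x * r * y))"
  shows "\<exists>E :: nat \<Rightarrow> 'a. \<forall>i<k. E i \<noteq> 0 \<and> E i * E i = E i \<and> (\<forall>j<k. i \<noteq> j \<longrightarrow> E i * E j = 0)"
proof (induction k)
  case 0
  then show ?case by simp
next
  case (Suc k)
  then obtain E :: "nat \<Rightarrow> 'a" where E: "\<And>i. i < k \<Longrightarrow> E i \<noteq> 0" "\<And>i. i < k \<Longrightarrow> E i * E i = E i"
    "\<And>i j. i < k \<Longrightarrow> j < k \<Longrightarrow> i \<noteq> j \<Longrightarrow> E i * E j = 0" by blast
  let ?e = "\<Sum>i<k. E i"
  have Ee: "E i * ?e = E i" "?e * E i = E i" if i: "i < k" for i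
  proof -
    have "E i * ?e = (\<Sum>j<k. if j = i then E i else 0)"
      unfolding sum_distrib_left by (rule sum.cong) (use E i in auto)
    then show "E i * ?e = E i" using i by simp
    have "?e * E i = (\<Sum>j<k. if j = i then E i else 0)"
      unfolding sum_distrib_right by (rule sum.cong) (use E i in auto)
    then show "?e * E i = E i" using i by simp
  qed
  have "?e * ?e = ?e"
    unfolding sum_distrib_left[of ?e] by (rule sum.cong) (use Ee in auto)
  then obtain f where f: "f \<noteq> 0" "f * f = f" "?e * f = 0" "f * ?e = 0"
    using idempotent_complement[OF inf fin] by blast
  have Ef: "E i * f = 0" "f * E i = 0" if "i < k" for i
    using Ee[OF that] f by (metis mult.assoc mult_zero_right mult_zero_left)+
  show ?case
    by (rule exI[of _ "E(k := f)"]) (auto simp: less_Suc_eq E f Ef)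
qed

text \<open>With \<open>x i\<close> in E i R E (i+1), only consecutive neighbours have a nonzero
  product, so every reordering vanishes, while primeness keeps the natural product nonzero. N + 1
  elements need N + 2 idempotents.\<close>

lemma ex_sequence_idempotents:
  fixes E :: "nat \<Rightarrow> 'a"
  assumes E: "\<And>i. i < N + 2 \<Longrightarrow> E i \<noteq> 0 \<and> E i * E i = E i"
    "\<And>i j. i < N + 2 \<Longrightarrow> j < N + 2 \<Longrightarrow> i \<noteq> j \<Longrightarrow> E i * E j = 0"
  shows "\<exists>x :: nat \<Rightarrow> 'a. seq_prod N x \<notin> group_closure (reordered N x)"
proof -
  have "\<exists>x. (\<forall>i\<le>n. x i = E i * x i * E (Suc i)) \<and> seq_prod n x \<noteq> 0" if "n \<le> N" for n
    using that
  proof (induction n)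
    case 0
    obtain r where "E 0 * r * E 1 \<noteq> 0" using prime E(1)[of 0] E(1)[of 1] by force
    moreover have "E 0 * r * E 1 = E 0 * (E 0 * r * E 1) * E 1"
      using E(1)[of 0] E(1)[of 1] by (simp add: mult.assoc) (simp flip: mult.assoc)
    ultimately show ?case by (intro exI[of _ "\<lambda>_. E 0 * r * E 1"]) simp
  next
    case (Suc n)
    then obtain x where x: "\<And>i. i \<le> n \<Longrightarrow> x i = E i * x i * E (Suc i)" "seq_prod n x \<noteq> 0" by auto
    let ?a = "E (Suc n)" and ?b = "E (Suc (Suc n))"
    have ab: "?a * ?a = ?a" "?b * ?b = ?b" "?b \<noteq> 0" using E(1)[of "Suc n"] E(1)[of "Suc (Suc n)"] Suc by auto
    obtain r where r: "seq_prod n x * r * ?b \<noteq> 0" using prime x(2) ab(3) by blast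
    have xa: "x n * ?a = x n"
      using x(1)[of n] ab(1) by (metis le_refl mult.assoc)
    have pa: "seq_prod n x * ?a = seq_prod n x"
      by (cases n) (use xa in \<open>simp_all add: mult.assoc\<close>)
    let ?x = "x(Suc n := ?a * r * ?b)"
    have 1: "seq_prod n ?x = seq_prod n x" by (rule seq_prod_cong) simp
    have "seq_prod (Suc n) ?x = seq_prod n x * ?a * r * ?b"
      unfolding seq_prod.simps 1 by (simp add: mult.assoc)
    then have "seq_prod (Suc n) ?x \<noteq> 0" using r pa by simp
    moreover have "?a * r * ?b = ?a * (?a * r * ?b) * ?b"
      using ab by (simp add: mult.assoc) (simp flip: mult.assoc)
    ultimately show ?case
    proof (intro exI[of _ ?x] conjI allI impI)
      fix i assume "i \<le> Suc n" "?a * r * ?b = ?a * (?a * r * ?b) * ?b"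
      then show "?x i = E i * ?x i * E (Suc i)"
        using x(1)[of i] by (cases "i = Suc n") auto
    qed
  qed
  then obtain x where x: "\<And>i. i \<le> N \<Longrightarrow> x i = E i * x i * E (Suc i)" "seq_prod N x \<noteq> 0" by blast
  have xx: "x i * x j = 0" if "i \<le> N" "j \<le> N" "j \<noteq> Suc i" for i j
  proof -
    have "x i * x j = E i * x i * (E (Suc i) * E j) * x j * E (Suc j)"
      using x(1)[OF that(1)] x(1)[OF that(2)] by (metis mult.assoc)
    also have "E (Suc i) * E j = 0" using E(2)[of "Suc i" j] that by simp
    finally show ?thesis by simp
  qed
  have "reordered N x \<subseteq> {0}"
  proof
    fix z assume "z \<in> reordered N x"
    then obtain h where z: "z = seq_prod N (\<lambda>j. x (h j))" and h: "h ` {..N} = {..N}" "\<exists>j\<le>N. h j \<noteq> j"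
      by (auto simp: reordered_def)
    have hN: "h j \<le> N" if "j \<le> N" for j using h(1) that by blast
    \<comment> \<open>Otherwise h j = h 0 + j, and h N \<le> N forces h 0 = 0, so that
      \<open>h\<close> is the identity.\<close>
    have "\<exists>j<N. h (Suc j) \<noteq> Suc (h j)"
    proof (rule ccontr)
      assume "\<not> ?thesis"
      then have s: "h (Suc j) = Suc (h j)" if "j < N" for j using that by blast
      have hj: "h j = h 0 + j" if "j \<le> N" for j
        using that by (induction j) (simp_all add: s)
      have "h 0 = 0" using hj[of N] hN[of N] by simp
      then have "h j = j" if "j \<le> N" for j using hj[OF that] by simp
      then show False using h(2) by blast
    qed
    then obtain j where j: "j < N" "h (Suc j) \<noteq> Suc (h j)" by blast
    then have "x (h j) * x (h (Suc j)) = 0" by (intro xx hN) simp_all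
    then show "z \<in> {0}" unfolding z using seq_prod_adjacent_zero[OF j(1), of "\<lambda>j. x (h j)"] by simp
  qed
  then have "group_closure (reordered N x) \<subseteq> {0}"
    by (intro group_closure_least) (simp_all add: add_subgroup_def)
  then show ?thesis using x(2) by blast
qed

end

section \<open>Words independent over a finite centroid\<close>

text \<open>B. H. Neumann's covering lemma for kernels. If only \<open>T\<^sub>d x \<in> V\<^sub>d\<close> can fail, choose \<open>x\<close> such that both
  \<open>x\<close> and \<open>x + y\<close> avoid the other sets; then \<open>T\<^sub>d y \<in> V\<^sub>d - V\<^sub>d\<close> for every \<open>y\<close>.\<close>

lemma finite_covering:
  fixes T :: "'i \<Rightarrow> 'a::ab_group_add \<Rightarrow> 'b::ab_group_add"
  assumes "finite E"
    and "\<And>e x y. e \<in> E \<Longrightarrow> T e (x + y) = T e x + T e y"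
    and "\<And>e. e \<in> E \<Longrightarrow> infinite (range (T e))"
    and "\<And>e. e \<in> E \<Longrightarrow> finite (V e)"
  shows "\<exists>x. \<forall>e\<in>E. T e x \<notin> V e"
  using assms
proof (induction E arbitrary: V rule: finite_induct)
  case empty
  then show ?case by simp
next
  case (insert d E)
  note add = insert.prems(1)
  show ?case
  proof (rule ccontr)
    assume no: "\<not> ?thesis"
    have d: "T d x \<in> V d" if "\<forall>e\<in>E. T e x \<notin> V e" for x
      using no that by blast
    have "range (T d) \<subseteq> (\<lambda>(u, v). u - v) ` (V d \<times> V d)"
    proof
      fix z assume "z \<in> range (T d)"
      then obtain y where z: "z = T d y" by blast
      have "\<exists>x. \<forall>e\<in>E. T e x \<notin> V e \<union> (\<lambda>v. v - T e y) ` V e"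
        by (rule insert.IH) (use insert.prems in auto)
      then obtain x where x: "\<And>e. e \<in> E \<Longrightarrow> T e x \<notin> V e \<union> (\<lambda>v. v - T e y) ` V e" by blast
      have "T d x \<in> V d" using d x by blast
      moreover have "T d (x + y) \<in> V d"
      proof (rule d, rule ballI, rule notI)
        fix e assume e: "e \<in> E" "T e (x + y) \<in> V e"
        then have "T e x = T e (x + y) - T e y" using add[of e x y] by simp
        then show False using x[OF e(1)] e(2) by blast
      qed
      moreover have "z = T d (x + y) - T d x" using add[of d x y] z by simp
      ultimately show "z \<in> (\<lambda>(u, v). u - v) ` (V d \<times> V d)" by force
    qed
    then have "finite (range (T d))"
      by (rule finite_subset) (use insert.prems(3)[of d] in simp)
    then show False using insert.prems(2)[of d] by simp
  qed
qed

definition centroid_independent :: "'i set \<Rightarrow> ('i \<Rightarrow> 'a::ring) \<Rightarrow> bool"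
  where "centroid_independent I b \<longleftrightarrow>
    (\<forall>c :: 'i \<Rightarrow> 'a centroid. (\<Sum>i\<in>I. c i \<bullet> b i) = 0 \<longrightarrow> (\<forall>i\<in>I. c i = 0))"

lemma centroid_independentD:
  "centroid_independent I b \<Longrightarrow> (\<Sum>i\<in>I. c i \<bullet> b i) = 0 \<Longrightarrow> i \<in> I \<Longrightarrow> c i = 0"
  by (auto simp: centroid_independent_def)

lemma centroid_independent_subset:
  assumes "centroid_independent I b" "finite I" "J \<subseteq> I"
  shows "centroid_independent J b"
  unfolding centroid_independent_def
proof (intro allI impI ballI)
  fix c :: "'a \<Rightarrow> 'b centroid" and i
  assume 0: "(\<Sum>i\<in>J. c i \<bullet> b i) = 0" and i: "i \<in> J"
  have "(\<Sum>i\<in>I. (if i \<in> J then c i else 0) \<bullet> b i) = (\<Sum>i\<in>J. (if i \<in> J then c i else 0) \<bullet> b i)"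
    by (rule sum.mono_neutral_right) (use assms in auto)
  also have "\<dots> = 0" using 0 by simp
  finally have "(if i \<in> J then c i else 0) = 0"
    by (rule centroid_independentD[OF assms(1)]) (use i assms(3) in auto)
  then show "c i = 0" using i by simp
qed

context simple_rng
begin

text \<open>A finite-valued \<open>\<Sum> a\<^sub>i x b\<^sub>i\<close> can be shortened by forming \<open>a\<^sub>j r T(x) - T(r a\<^sub>j x)\<close>.\<close>

lemma finite_range_coeffs_zero:
  fixes a b :: "'i \<Rightarrow> 'a"
  assumes inf: "\<And>a b :: 'a. a \<noteq> 0 \<Longrightarrow> b \<noteq> 0 \<Longrightarrow> infinite (range (\<lambda>r. a * r * b))"
    and "finite I" "centroid_independent I b" "finite (range (\<lambda>x. \<Sum>i\<in>I. a i * x * b i))"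
    and "i \<in> I"
  shows "a i = 0"
proof -
  have "\<forall>a. centroid_independent I b \<longrightarrow> finite (range (\<lambda>x. \<Sum>i\<in>I. a i * x * b i)) \<longrightarrow> (\<forall>i\<in>I. a i = 0)"
    using assms(2)
  proof (induction I rule: finite_induct)
    case empty
    then show ?case by simp
  next
    case (insert j I)
    show ?case
    proof (intro allI impI)
      fix a :: "'i \<Rightarrow> 'a"
      let ?T = "\<lambda>x. \<Sum>i\<in>insert j I. a i * x * b i"
      assume ind: "centroid_independent (insert j I) b" and fin: "finite (range ?T)"
      have ind': "centroid_independent I b"
        using centroid_independent_subset[OF ind] insert.hyps(1) by blast
      have "a j = 0"
      proof (rule ccontr)
        assume aj: "a j \<noteq> 0"
        have "\<exists>c. a i = c \<bullet> a j" if i: "i \<in> I" for i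
        proof (rule martindale[OF _ aj])
          fix r
          let ?a = "\<lambda>i. a j * r * a i - a i * r * a j"
          have eq: "(\<Sum>i\<in>I. ?a i * x * b i) = a j * r * ?T x - ?T (r * a j * x)" for x
            using insert.hyps
            by (simp add: sum_distrib_left distrib_left left_diff_distrib sum_subtractf mult.assoc)
          have "range (\<lambda>x. \<Sum>i\<in>I. ?a i * x * b i) \<subseteq> (\<lambda>(u, v). a j * r * u - v) ` (range ?T \<times> range ?T)"
            unfolding eq by auto
          then have "finite (range (\<lambda>x. \<Sum>i\<in>I. ?a i * x * b i))"
            by (rule finite_subset) (use fin in simp)
          then have "\<forall>i\<in>I. ?a i = 0" using insert.IH[THEN spec, of ?a] ind' by blast
          then have "?a i = 0" using i by blast
          then show "a j * r * a i = a i * r * a j" by simp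
        qed
        then have "\<forall>i. \<exists>c. i \<in> I \<longrightarrow> a i = c \<bullet> a j" by blast
        from choice[OF this] obtain c where c: "a i = c i \<bullet> a j" if "i \<in> I" for i by blast
        \<comment> \<open>All coefficients are multiples of \<open>a j\<close>, so the map collapses
          to \<open>a j * x * ?b\<close>; independence makes \<open>?b\<close> nonzero since its
          coefficient at \<open>j\<close> is 1.\<close>
        define d where "d = c(j := 1)"
        let ?b = "\<Sum>i\<in>insert j I. d i \<bullet> b i"
        have d: "a i = d i \<bullet> a j" if "i \<in> insert j I" for i
          using that c by (auto simp: d_def)
        have "?b \<noteq> 0"
        proof
          assume "?b = 0"
          then have "d j = 0" using centroid_independentD[OF ind] by blast
          then have "a j = 0" using d[of j] by simp
          then show False using aj by simp
        qed
        moreover have "?T x = a j * x * ?b" for x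
          unfolding sum_distrib_left
          by (intro sum.cong refl) (subst d, assumption, simp add: centroid_mult_left centroid_mult_right)
        ultimately show False using fin inf[OF aj] by simp
      qed
      then show "\<forall>i\<in>insert j I. a i = 0"
        using insert.IH ind' fin insert.hyps by simp
    qed
  qed
  then show ?thesis using assms(3-5) by blast
qed

end

text \<open>The separator \<open>w\<close> replaces a unit: the empty word has value
  \<open>w\<close>, and joining words u and v by a new letter x is the insertion u x v, linear in
  x.\<close>

primrec word_value :: "'a::ring \<Rightarrow> (nat \<Rightarrow> 'a) \<Rightarrow> nat list \<Rightarrow> 'a"
  where
    "word_value w r [] = w"
  | "word_value w r (i # l) = w * r i * word_value w r l"

lemma word_value_append: "word_value w r (u @ i # v) = word_value w r u * r i * word_value w r v"
  by (induction u) (simp_all add: mult.assoc)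

lemma word_value_cong: "(\<And>i. i \<in> set l \<Longrightarrow> r i = s i) \<Longrightarrow> word_value w r l = word_value w s l"
  by (induction l) simp_all

lemma word_value_seq_prod:
  "word_value w r (map h [0..<Suc n]) = w * seq_prod n (\<lambda>j. r (h j) * w)"
proof (induction n)
  case 0
  then show ?case by (simp add: mult.assoc)
next
  case (Suc n)
  have "map h [0..<Suc (Suc n)] = map h [0..<Suc n] @ h (Suc n) # []" by simp
  then show ?case by (simp only: word_value_append Suc) (simp add: mult.assoc)
qed

definition distinct_words :: "nat \<Rightarrow> nat list set"
  where "distinct_words k = {l. distinct l \<and> set l \<subseteq> {..<k}}"

lemma finite_distinct_words: "finite (distinct_words k)"
  unfolding distinct_words_def
  by (rule finite_subset[OF _ finite_subset_distinct[of "{..<k}"]]) auto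

lemma distinct_words_Suc:
  "distinct_words (Suc k) = distinct_words k \<union>
    (\<lambda>(u, v). u @ k # v) ` {(u, v) \<in> distinct_words k \<times> distinct_words k. distinct (u @ v)}"
  (is "?L = ?R")
proof (intro equalityI subsetI)
  fix l assume l: "l \<in> ?L"
  show "l \<in> ?R"
  proof (cases "k \<in> set l")
    case False
    then have "l \<in> distinct_words k" using l by (auto simp: distinct_words_def less_Suc_eq)
    then show ?thesis by blast
  next
    case True
    then obtain u v where uv: "l = u @ k # v" by (meson split_list)
    then have "(u, v) \<in> {(u, v) \<in> distinct_words k \<times> distinct_words k. distinct (u @ v)}"
      using l by (auto simp: distinct_words_def less_Suc_eq)
    then show ?thesis unfolding uv by (intro UnI2 image_eqI[where x = "(u, v)"]) simp_all
  qed
qed (auto simp: distinct_words_def less_Suc_eq)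

context simple_rng
begin

text \<open>A word with the new letter has a value linear in x. No nontrivial combination of such
  values may fall into the span of the old words; as the centroid is finite, there are finitely many
  combinations and the span is finite, so \<open>finite_covering\<close> applies.\<close>

lemma independent_words_Suc:
  fixes w :: 'a and r :: "nat \<Rightarrow> 'a"
  assumes inf: "\<And>a b :: 'a. a \<noteq> 0 \<Longrightarrow> b \<noteq> 0 \<Longrightarrow> infinite (range (\<lambda>r. a * r * b))"
    and fin: "finite (UNIV :: 'a centroid set)"
    and ind: "centroid_independent (distinct_words k) (word_value w r)"
  shows "\<exists>x. centroid_independent (distinct_words (Suc k)) (word_value w (r(k := x)))"
proof -
  let ?D = "distinct_words k"
  let ?v = "word_value w r"
  let ?E = "{e \<in> PiE (?D \<times> ?D) (\<lambda>_. UNIV :: 'a centroid set). \<exists>p\<in>?D \<times> ?D. e p \<noteq> 0}"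
  let ?T = "\<lambda>e x. \<Sum>(u, v)\<in>?D \<times> ?D. e (u, v) \<bullet> (?v u * x * ?v v)"
  let ?V = "(\<lambda>c. \<Sum>l\<in>?D. c l \<bullet> ?v l) ` PiE ?D (\<lambda>_. UNIV :: 'a centroid set)"
  have fD: "finite ?D" by (rule finite_distinct_words)
  have T: "?T e x = (\<Sum>v\<in>?D. (\<Sum>u\<in>?D. e (u, v) \<bullet> ?v u) * x * ?v v)" for e x
    unfolding sum.cartesian_product[symmetric]
    by (subst sum.swap) (simp add: sum_distrib_right centroid_mult_left)
  have "\<exists>x. \<forall>e\<in>?E. ?T e x \<notin> ?V"
  proof (rule finite_covering)
    have "finite (PiE (?D \<times> ?D) (\<lambda>_. UNIV :: 'a centroid set))"
      using fD fin by (intro finite_PiE) auto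
    then show "finite ?E" by simp
    show "?T e (x + y) = ?T e x + ?T e y" for e x y
      unfolding T by (simp add: distrib_left distrib_right sum.distrib)
    show "finite ?V"
      using fD fin by (intro finite_imageI finite_PiE) auto
    fix e assume e: "e \<in> ?E"
    show "infinite (range (?T e))"
    proof
      assume "finite (range (?T e))"
      then have fr: "finite (range (\<lambda>x. \<Sum>v\<in>?D. (\<Sum>u\<in>?D. e (u, v) \<bullet> ?v u) * x * ?v v))"
        unfolding T .
      \<comment> \<open>Independence is used twice: here for the right factors, next for the left
        ones.\<close>
      have "(\<Sum>u\<in>?D. e (u, v) \<bullet> ?v u) = 0" if "v \<in> ?D" for v
        by (rule finite_range_coeffs_zero[where a = "\<lambda>v. \<Sum>u\<in>?D. e (u, v) \<bullet> ?v u" and b = ?v])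
          (fact inf fD ind fr that)+
      then have "e (u, v) = 0" if "u \<in> ?D" "v \<in> ?D" for u v
        using centroid_independentD[OF ind, of "\<lambda>u. e (u, v)"] that by blast
      then show False using e by auto
    qed
  qed
  then obtain x where x: "?T e x \<notin> ?V" if "e \<in> ?E" for e by blast
  let ?r = "r(k := x)"
  let ?Q = "{(u, v) \<in> ?D \<times> ?D. distinct (u @ v)}"
  let ?f = "\<lambda>(u, v). u @ k # v"
  have notk: "k \<notin> set l" if "l \<in> ?D" for l using that by (auto simp: distinct_words_def)
  have vr: "word_value w ?r l = ?v l" if "l \<in> ?D" for l
    by (rule word_value_cong) (use notk[OF that] in auto)
  have inj: "inj_on ?f ?Q"
    using notk by (auto simp: inj_on_def append_Cons_eq_iff)
  have disj: "?D \<inter> ?f ` ?Q = {}" using notk by fastforce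
  have fQ: "finite ?Q" using fD by (rule_tac finite_subset[of _ "?D \<times> ?D"]) auto
  have "c l = 0" if c: "(\<Sum>l\<in>distinct_words (Suc k). c l \<bullet> word_value w ?r l) = 0"
    and l: "l \<in> distinct_words (Suc k)" for c :: "nat list \<Rightarrow> 'a centroid" and l
  proof -
    define e where "e = restrict (\<lambda>(u, v). if distinct (u @ v) then c (u @ k # v) else 0) (?D \<times> ?D)"
    have "(\<Sum>l\<in>?f ` ?Q. c l \<bullet> word_value w ?r l)
        = (\<Sum>(u, v)\<in>?Q. c (u @ k # v) \<bullet> word_value w ?r (u @ k # v))"
      unfolding sum.reindex[OF inj] by (simp add: case_prod_unfold)
    also have "\<dots> = (\<Sum>(u, v)\<in>?Q. e (u, v) \<bullet> (?v u * x * ?v v))"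
      by (rule sum.cong[OF refl]) (auto simp: e_def word_value_append vr)
    also have "\<dots> = ?T e x"
      by (rule sum.mono_neutral_left) (use fD in \<open>auto simp: e_def split: if_splits\<close>)
    finally have split: "(\<Sum>l\<in>?D. c l \<bullet> ?v l) + ?T e x = 0"
      using c unfolding distinct_words_Suc sum.union_disjoint[OF fD finite_imageI[OF fQ] disj]
      by (simp add: vr)
    have e0: "e p = 0" if "p \<in> ?D \<times> ?D" for p
    proof (rule ccontr)
      assume "e p \<noteq> 0"
      moreover have "e \<in> PiE (?D \<times> ?D) (\<lambda>_. UNIV)" by (simp add: e_def)
      ultimately have "e \<in> ?E" using that by blast
      have "?T e x = (\<Sum>l\<in>?D. restrict (\<lambda>l. - c l) ?D l \<bullet> ?v l)"
        using split by (simp add: sum_negf eq_neg_iff_add_eq_0 add.commute)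
      then have "?T e x \<in> ?V"
        by (intro image_eqI[where x = "restrict (\<lambda>l. - c l) ?D"]) auto
      with \<open>e \<in> ?E\<close> show False using x by blast
    qed
    have "?T e x = 0" by (rule sum.neutral) (use e0 in auto)
    then have "(\<Sum>l\<in>?D. c l \<bullet> ?v l) = 0" using split by simp
    then have cD: "c l = 0" if "l \<in> ?D" for l
      using centroid_independentD[OF ind] that by blast
    show "c l = 0"
      using l unfolding distinct_words_Suc
    proof
      assume "l \<in> ?f ` ?Q"
      then obtain u v where uv: "l = u @ k # v" "u \<in> ?D" "v \<in> ?D" "distinct (u @ v)" by auto
      then show ?thesis using e0[of "(u, v)"] by (simp add: e_def)
    qed (rule cD)
  qed
  then show ?thesis unfolding centroid_independent_def by blast
qed

lemma independent_words:
  fixes w :: 'a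
  assumes inf: "\<And>a b :: 'a. a \<noteq> 0 \<Longrightarrow> b \<noteq> 0 \<Longrightarrow> infinite (range (\<lambda>r. a * r * b))"
    and fin: "finite (UNIV :: 'a centroid set)" and w: "w \<noteq> 0"
  shows "\<exists>r. centroid_independent (distinct_words k) (word_value w r)"
proof (induction k)
  case 0
  have "distinct_words 0 = {[]}" by (auto simp: distinct_words_def)
  then show ?case using centroid_app_eq_0 w by (auto simp: centroid_independent_def)
next
  case (Suc k)
  then show ?case using independent_words_Suc[OF inf fin] by blast
qed

text \<open>With x j = r j w, left multiplication by \<open>w\<close> turns products into word
  values; a reordering is a different word, and independence separates it from the natural
  one.\<close>

lemma ex_sequence_finite_centroid:
  assumes inf: "\<And>a b :: 'a. a \<noteq> 0 \<Longrightarrow> b \<noteq> 0 \<Longrightarrow> infinite (range (\<lambda>r. a * r * b))"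
    and fin: "finite (UNIV :: 'a centroid set)"
  shows "\<exists>x :: nat \<Rightarrow> 'a. seq_prod N x \<notin> group_closure (reordered N x)"
proof -
  obtain w :: 'a where w: "w \<noteq> 0" using square_nonzero by (metis mult_zero_left)
  obtain r where ind: "centroid_independent (distinct_words (Suc N)) (word_value w r)"
    using independent_words[OF inf fin w] by blast
  let ?D = "distinct_words (Suc N)"
  let ?v = "word_value w r"
  let ?l = "[0..<Suc N]"
  define x where "x = (\<lambda>j. r j * w)"
  have fD: "finite ?D" by (rule finite_distinct_words)
  have lD: "?l \<in> ?D" by (auto simp: distinct_words_def)
  let ?S = "{z. \<exists>c. w * z = (\<Sum>l\<in>?D - {?l}. c l \<bullet> ?v l)}"
  have S: "add_subgroup ?S"
    unfolding add_subgroup_def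
  proof (intro conjI ballI)
    show "0 \<in> ?S" by (simp, rule exI[of _ "\<lambda>_. 0"]) simp
    fix y z assume "y \<in> ?S" "z \<in> ?S"
    then obtain c d where "w * y = (\<Sum>l\<in>?D - {?l}. c l \<bullet> ?v l)" "w * z = (\<Sum>l\<in>?D - {?l}. d l \<bullet> ?v l)"
      by blast
    then have "w * (y - z) = (\<Sum>l\<in>?D - {?l}. (c l - d l) \<bullet> ?v l)"
      by (simp only: right_diff_distrib centroid_diff_left sum_subtractf)
    then show "y - z \<in> ?S" by (intro CollectI) (rule exI[of _ "\<lambda>l. c l - d l"])
  qed
  have "reordered N x \<subseteq> ?S"
  proof
    fix z assume "z \<in> reordered N x"
    then obtain h where z: "z = seq_prod N (\<lambda>j. x (h j))" and h: "h ` {..N} = {..N}" "\<exists>j\<le>N. h j \<noteq> j"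
      by (auto simp: reordered_def)
    let ?h = "map h ?l"
    have "{0..<Suc N} = {..N}" by auto
    then have hD: "?h \<in> ?D"
      using h(1) surj_words_inj[OF h(1)] by (auto simp: distinct_words_def distinct_map simp del: upt_Suc)
    have "?h \<noteq> ?l"
    proof
      assume "?h = ?l"
      then have "map h ?l = map (\<lambda>j. j) ?l" by simp
      then have "\<forall>j\<in>set ?l. h j = j" unfolding map_eq_conv .
      then show False using h(2) by (auto simp del: upt_Suc)
    qed
    then have "(\<Sum>l\<in>?D - {?l}. (if l = ?h then 1 else 0) \<bullet> ?v l) = (\<Sum>l\<in>{?h}. (if l = ?h then 1 else 0) \<bullet> ?v l)"
      using fD hD by (intro sum.mono_neutral_right) auto
    also have "\<dots> = w * z"
      unfolding z x_def word_value_seq_prod[symmetric] by (simp del: upt_Suc)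
    finally show "z \<in> ?S" by (intro CollectI, intro exI) (rule sym)
  qed
  then have sub: "group_closure (reordered N x) \<subseteq> ?S" by (rule group_closure_least[OF S])
  have "seq_prod N x \<notin> ?S"
  proof
    assume "seq_prod N x \<in> ?S"
    then obtain c where c: "w * seq_prod N x = (\<Sum>l\<in>?D - {?l}. c l \<bullet> ?v l)" by blast
    have vl: "w * seq_prod N x = ?v ?l"
      unfolding x_def using word_value_seq_prod[of w r "\<lambda>j. j" N] by (simp del: upt_Suc)
    let ?c = "c(?l := - 1)"
    have "(\<Sum>l\<in>?D. ?c l \<bullet> ?v l) = - ?v ?l + (\<Sum>l\<in>?D - {?l}. ?c l \<bullet> ?v l)"
      by (subst sum.remove[OF fD lD]) (simp del: upt_Suc)
    also have "(\<Sum>l\<in>?D - {?l}. ?c l \<bullet> ?v l) = (\<Sum>l\<in>?D - {?l}. c l \<bullet> ?v l)"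
      by (rule sum.cong) (auto simp del: upt_Suc)
    finally have "(\<Sum>l\<in>?D. ?c l \<bullet> ?v l) = 0" using c vl by simp
    then have "?c ?l = 0" using centroid_independentD[OF ind] lD by blast
    then have "(- 1 :: 'a centroid) \<bullet> w = 0 \<bullet> w" by simp
    then show False using w by simp
  qed
  then show ?thesis using sub by blast
qed

section \<open>Combination of the two cases and passage from algebras to rings\<close>

lemma commutator_group_subset_additive:
  fixes A :: "'a set" and c :: "nat \<Rightarrow> 'a centroid"
  assumes inf: "infinite (UNIV :: 'a set)" and nc: "x * y \<noteq> y * (x :: 'a)"
    and A: "add_subgroup A"
    and mem: "\<And>a b. (\<Sum>k<Suc m. c k \<bullet> power_commutator k a b) \<in> A" and cm: "c m \<noteq> 0"
  shows "commutator_group \<subseteq> A"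
proof (cases "infinite (UNIV :: 'a centroid set)")
  case True
  then show ?thesis by (rule commutator_group_subset_infinite_centroid[OF _ nc A mem cm])
next
  case fin: False
  let ?N = "4 * m + 3"
  have "\<exists>x :: nat \<Rightarrow> 'a. seq_prod ?N x \<notin> group_closure (reordered ?N x)"
  proof (cases "\<exists>a b :: 'a. a \<noteq> 0 \<and> b \<noteq> 0 \<and> finite (range (\<lambda>r. a * r * b))")
    case True
    then have "finite (range (\<lambda>r. x * r * y))" for x y :: 'a
      using sandwich_finite_everywhere by blast
    then obtain E :: "nat \<Rightarrow> 'a" where
      "\<forall>i<?N + 2. E i \<noteq> 0 \<and> E i * E i = E i \<and> (\<forall>j<?N + 2. i \<noteq> j \<longrightarrow> E i * E j = 0)"
      using orthogonal_idempotents[OF inf, of "?N + 2"] by blast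
    then show ?thesis by (intro ex_sequence_idempotents[of ?N E]) blast+
  next
    case False
    then show ?thesis using fin by (intro ex_sequence_finite_centroid) auto
  qed
  then show ?thesis using commutator_group_subset_if_sequence[OF _ A mem cm] by blast
qed

end

text \<open>The span of R I R is a subspace because a scalar moves into the left factor, so algebra
  simplicity applies to it. It lies in \<open>I\<close>, and if it is 0, so is
  \<open>I\<close>.\<close>

lemma (in simple_algebra) simple_rng: "simple_rng TYPE('a)"
proof
  show "\<exists>x y :: 'a. x * y \<noteq> 0" by (rule square_nonzero)
  have ann: "x = 0" if x: "\<And>r s. r * x * s = 0" for x :: 'a
  proof -
    have 1: "y = 0" if "\<And>s. s * y = 0" for y :: 'a
    proof -
      have "two_sided_ideal {y. \<forall>s. s * y = 0}"
        by (auto simp: two_sided_ideal_def subspace_def distrib_left scale_mult_right simp flip: mult.assoc)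
      then have "{y :: 'a. \<forall>s. s * y = 0} = {0} \<or> {y :: 'a. \<forall>s. s * y = 0} = UNIV"
        by (rule trivial_ideals)
      moreover have "{y :: 'a. \<forall>s. s * y = 0} \<noteq> UNIV" using square_nonzero by auto
      ultimately show ?thesis using that by blast
    qed
    have 2: "y = 0" if "\<And>s. y * s = 0" for y :: 'a
    proof -
      have "two_sided_ideal {y. \<forall>s. y * s = 0}"
        by (auto simp: two_sided_ideal_def subspace_def distrib_right scale_mult_left mult.assoc)
      then have "{y :: 'a. \<forall>s. y * s = 0} = {0} \<or> {y :: 'a. \<forall>s. y * s = 0} = UNIV"
        by (rule trivial_ideals)
      moreover have "{y :: 'a. \<forall>s. y * s = 0} \<noteq> UNIV" using square_nonzero by auto
      ultimately show ?thesis using that by blast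
    qed
    show ?thesis using x 1 2 by blast
  qed
  fix I :: "'a set"
  assume I: "add_subgroup I" "\<And>r x. x \<in> I \<Longrightarrow> r * x \<in> I \<and> x * r \<in> I"
  let ?J = "group_closure {r * x * s | r x s. x \<in> I}"
  have J: "add_subgroup ?J" by simp
  note d = add_subgroupD[OF J]
  have closed: "f z \<in> ?J" if z: "z \<in> ?J" and f: "\<And>x y. f (x - y) = f x - f y" "f 0 = 0"
    and gen: "\<And>r x s. x \<in> I \<Longrightarrow> f (r * x * s) \<in> {r * x * s | r x s. x \<in> I}" for f z
  proof -
    have "add_subgroup {z. f z \<in> ?J}" using d f by (auto simp: add_subgroup_def)
    then have "z \<in> {z. f z \<in> ?J}"
      by (rule group_closure_induct_subset[OF z]) (use gen in \<open>blast intro: group_closure.base\<close>)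
    then show ?thesis by simp
  qed
  have "two_sided_ideal ?J"
    unfolding two_sided_ideal_def subspace_def
  proof (intro conjI ballI allI)
    show "0 \<in> ?J" "\<And>x y. x \<in> ?J \<Longrightarrow> y \<in> ?J \<Longrightarrow> x + y \<in> ?J" by (rule d, assumption?)+
    fix z assume z: "z \<in> ?J"
    show "c *s z \<in> ?J" for c
      by (rule closed[OF z]) (simp_all add: scale_right_diff_distrib, metis scale_mult_left)
    show "r * z \<in> ?J" for r
      by (rule closed[OF z]) (simp_all add: right_diff_distrib, metis mult.assoc)
    show "z * r \<in> ?J" for r
      by (rule closed[OF z]) (simp_all add: left_diff_distrib, metis mult.assoc)
  qed
  then have "?J = {0} \<or> ?J = UNIV" by (rule trivial_ideals)
  then show "I = {0} \<or> I = UNIV"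
  proof
    assume J0: "?J = {0}"
    have "x = 0" if "x \<in> I" for x
    proof (rule ann)
      fix r s
      have "r * x * s \<in> ?J" using that by (intro group_closure.base) blast
      then show "r * x * s = 0" unfolding J0 by simp
    qed
    then show ?thesis using add_subgroupD(1)[OF I(1)] by blast
  next
    assume "?J = UNIV"
    moreover have "?J \<subseteq> I" by (rule group_closure_least[OF I(1)]) (use I(2) in blast)
    ultimately show ?thesis by blast
  qed
qed

theorem corollary46:
  fixes scale :: "'f::field \<Rightarrow> 'a::ring \<Rightarrow> 'a"
    and p :: "'f poly"
  assumes simple: "simple_algebra scale"
    and noncommutative: "\<exists>a b :: 'a. a * b \<noteq> b * a"
    and nonconstant: "degree p > 0"
    and no_constant_term: "\<not> unital TYPE('a) \<Longrightarrow> coeff p 0 = 0"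
    and infinite: "infinite (UNIV :: 'a set)"
  shows "group_closure (poly_commutators scale p) = commutator_group \<and>
    subring_closure (poly_commutators scale p) = UNIV"
proof -
  interpret simple_algebra scale by (rule simple)
  interpret simple_rng "TYPE('a)" by (rule simple_rng)
  obtain x y :: 'a where nc: "x * y \<noteq> y * x" using noncommutative by blast
  obtain m where m: "degree p = Suc m" using nonconstant by (cases "degree p") auto
  define c :: "nat \<Rightarrow> 'a centroid" where "c = (\<lambda>k. Centroid (scale (coeff p (Suc k))))"
  have c: "c k \<bullet> z = scale (coeff p (Suc k)) z" for k z
    unfolding c_def
    by (subst Centroid_inverse) (simp_all add: scale_right_distrib scale_mult_left scale_mult_right)
  have cm: "c m \<noteq> 0"
  proof
    assume "c m = 0"
    then have "scale (lead_coeff p) (x * y - y * x) = 0"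
      using c[of m "x * y - y * x"] m by simp
    moreover have "lead_coeff p \<noteq> 0" using nonconstant by auto
    ultimately show False using nc by (simp only: scale_eq_0_iff) simp
  qed
  \<comment> \<open>The constant term cancels in the difference.\<close>
  have ev: "eval_poly scale p (a * b) - eval_poly scale p (b * a)
      = (\<Sum>k<Suc m. c k \<bullet> power_commutator k a b)" for a b
    by (simp only: eval_poly_def m c power_commutator_def scale_right_diff_distrib sum_subtractf) simp
  let ?A = "group_closure (poly_commutators scale p)"
  have "(\<Sum>k<Suc m. c k \<bullet> power_commutator k a b) \<in> ?A" for a b
    unfolding ev[symmetric] by (rule group_closure.base) (auto simp: poly_commutators_def)
  then have 1: "commutator_group \<subseteq> ?A"
    by (intro commutator_group_subset_additive[where c = c and m = m, OF infinite nc _ _ cm]) simp_all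
  \<comment> \<open>(ab)^(k+1) - (ba)^(k+1) = [a, b (ab)^k], and the scalar moves into the second
    argument; k = 0 is separate for lack of a unit.\<close>
  have lie_mem: "c k \<bullet> power_commutator k a b \<in> commutator_group" for k a b
  proof -
    have "\<exists>z. power_commutator k a b = lie a z"
    proof (cases k)
      case 0
      then have "power_commutator k a b = lie a b" by (simp add: power_commutator_def lie_def)
      then show ?thesis ..
    next
      case (Suc j)
      have "b * ring_power (a * b) j * a = ring_power (b * a) (Suc j)" for j
        by (induction j) (simp_all add: mult.assoc)
      then have "power_commutator k a b = lie a (b * ring_power (a * b) j)"
        by (simp add: Suc power_commutator_def lie_def mult.assoc)
      then show ?thesis ..
    qed
    then obtain z where "power_commutator k a b = lie a z" ..
    then have "c k \<bullet> power_commutator k a b = lie a (c k \<bullet> z)" by (simp add: centroid_lie)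
    then show ?thesis unfolding commutator_group_eq by (intro group_closure.base) blast
  qed
  have "?A \<subseteq> commutator_group"
  proof (rule group_closure_least)
    show cg: "add_subgroup (commutator_group :: 'a set)" by (simp add: commutator_group_eq)
    show "poly_commutators scale p \<subseteq> commutator_group"
      unfolding poly_commutators_def ev by (auto intro!: add_subgroup_sum[OF cg] lie_mem simp del: sum.lessThan_Suc)
  qed
  then show ?thesis using 1 subring_closure_commutators[OF nc 1] by blast
qed

end
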